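(* Let $\underline{\mathsf{Cyl}}=(\mathsf{Cyl},i_0,i_1,p,v,\mathsf S,r_0,r_1,s,\Gamma_{ul})$ be a cylinder in a formal category $\mathcal A$ equipped with a contraction structure $p$, an involution structure $v$ compatible with $p$, a subdivision structure $(\mathsf S,r_0,r_1,s)$ compatible with $p$, and an upper left connection structure $\Gamma_{ul}$. Suppose that $\mathsf{Cyl}$ preserves subdivision with respect to $\underline{\mathsf{Cyl}}$. Let $j_0:a_0\to a$ and $j_1:a_1\to a$ be arrows of $\mathcal A$ which are fibrations with respect to $\underline{\mathsf{Cyl}}$. Let $f:a_0\to a_1$ be an arrow of $\mathcal A$ such that $j_1\circ f=j_0$ and such that $f$ is a homotopy equivalence with respect to $\underline{\mathsf{Cyl}}$. Then $f$ is, moreover, a homotopy equivalence over $a$ with respect to $\underline{\mathsf{Cyl}}$ and $(j_0,j_1)$.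
   Context: Formal categories. Let $\mathcal C$ be a strict 2-category with a final object $1$. For an object $\mathcal A$ of $\mathcal C$, an object of $\mathcal A$ is a 1-arrow $1\to\mathcal A$ and an arrow of $\mathcal A$ is a 2-arrow between such; composition, commutative diagrams, pushouts and pullbacks in $\mathcal A$ are those of the category $\mathrm{Hom}_{\mathcal C}(1,\mathcal A)$. For 1-arrows $F,F_0,F_1:\mathcal A\to\mathcal A$, a 2-arrow $\eta:F_0\to F_1$, an object $a$ and an arrow $f$ of $\mathcal A$: $F(a)=F\circ a$, $F(f)$ is the whiskering of $F$ and $f$, $\eta(a):F_0(a)\to F_1(a)$ is the whiskering of $\eta$ and $a$; $F\cdot\eta$, $\eta\cdot F$ are whiskerings. Standing assumption: for all objects $\mathcal A_0,\mathcal A_1$ of $\mathcal C$ and objects $a$ of $\mathcal A_0$, evaluation at $a$ sends pushout (resp. pullback) squares of $\mathrm{Hom}_{\mathcal C}(\mathcal A_0,\mathcal A_1)$ to pushout (resp. pullback) squares of $\mathcal A_1$. (For $\mathcal C$ the 2-category of categories these are ordinary categories, functors and natural transformations.) $\mathcal A$ is a fixed object of $\mathcal C$. A cylinder in $\mathcal A$ is a 1-arrow $\mathsf{Cyl}:\mathcal A\to\mathcal A$ with 2-arrows $i_0,i_1:\mathrm{id}_{\mathcal A}\to\mathsf{Cyl}$. Contraction structure: a 2-arrow $p:\mathsf{Cyl}\to\mathrm{id}_{\mathcal A}$ with $pi_0=pi_1=\mathrm{id}$. Involution structure: $v:\mathsf{Cyl}\to\mathsf{Cyl}$ with $vi_0=i_1$,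 $vi_1=i_0$; compatible with $p$ if $pv=p$. Subdivision structure: a 1-arrow $\mathsf S:\mathcal A\to\mathcal A$, 2-arrows $r_0,r_1:\mathsf{Cyl}\to\mathsf S$ with $r_0i_0=r_1i_1$ a pushout square of $i_0$ and $i_1$ in $\mathrm{Hom}_{\mathcal C}(\mathcal A,\mathcal A)$, and $s:\mathsf{Cyl}\to\mathsf S$ with $si_0=r_1i_0$, $si_1=r_0i_1$; compatible with $p$ if $\overline ps=p$, where $\overline p:\mathsf S\to\mathrm{id}_{\mathcal A}$ is the unique 2-arrow with $\overline pr_0=\overline pr_1=p$. Upper left connection structure: $\Gamma_{ul}:\mathsf{Cyl}^2\to\mathsf{Cyl}$ with $\Gamma_{ul}(i_0\cdot\mathsf{Cyl})=\Gamma_{ul}(\mathsf{Cyl}\cdot i_0)=\mathrm{id}$, $\Gamma_{ul}(i_1\cdot\mathsf{Cyl})=\Gamma_{ul}(\mathsf{Cyl}\cdot i_1)=i_1p$. $\mathsf{Cyl}$ preserves subdivision if the square $(\mathsf{Cyl}\cdot r_0)(\mathsf{Cyl}\cdot i_0)=(\mathsf{Cyl}\cdot r_1)(\mathsf{Cyl}\cdot i_1)$ is a pushout in $\mathrm{Hom}_{\mathcal C}(\mathcal A,\mathcal A)$. A homotopy from $f_0$ to $f_1$ ($f_0,f_1:a_0\to a_1$) is an arrow $h:\mathsf{Cyl}(a_0)\to a_1$ with $h\circ i_0(a_0)=f_0$, $h\circ i_1(a_0)=f_1$. $f:a_0\to a_1$ is a homotopy equivalence if there are $f^{-1}:a_1\to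 a_0$ and homotopies from $f^{-1}f$ to $\mathrm{id}(a_0)$ and from $ff^{-1}$ to $\mathrm{id}(a_1)$. Given $j_0:a_0\to a$, $j_1:a_1\to a$ and $f_0,f_1:a_0\to a_1$ with $j_1f_0=j_1f_1=j_0$, a homotopy over $a$ from $f_0$ to $f_1$ with respect to $(j_0,j_1)$ is a homotopy $h$ from $f_0$ to $f_1$ with $j_1\circ h=p(a)\circ\mathsf{Cyl}(j_0)$. An arrow $f:a_0\to a_1$ with $j_1f=j_0$ is a homotopy equivalence over $a$ with respect to $(j_0,j_1)$ if there is $f^{-1}:a_1\to a_0$ with $j_0f^{-1}=j_1$, a homotopy over $a$ from $f^{-1}f$ to $\mathrm{id}(a_0)$ with respect to $(j_0,j_0)$, and a homotopy over $a$ from $ff^{-1}$ to $\mathrm{id}(a_1)$ with respect to $(j_1,j_1)$. Fibration with respect to $\underline{\mathsf{Cyl}}$: $f:a_1\to a_2$ such that for all $g:a_0\to a_1$, $h:\mathsf{Cyl}(a_0)\to a_2$ with $h\circ i_0(a_0)=f\circ g$ there is $l:\mathsf{Cyl}(a_0)\to a_1$ with $l\circ i_0(a_0)=g$ and $f\circ l=h$. *)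

theory Defs
  imports Main
begin
record ('o, 'a) category_data =
  Obj :: "'o set"
  Arr :: "'a set"
  Dom :: "'a \<Rightarrow> 'o"
  Cod :: "'a \<Rightarrow> 'o"
  Id :: "'o \<Rightarrow> 'a"
  Comp :: "'a \<Rightarrow> 'a \<Rightarrow> 'a"

definition hom :: "('o, 'a) category_data \<Rightarrow> 'o \<Rightarrow> 'o \<Rightarrow> 'a set" where
  "hom C x y = {f \<in> Arr C. Dom C f = x \<and> Cod C f = y}"

text \<open>\<open>Comp C g f\<close> is \<open>g\<close> after \<open>f\<close>; its value is unconstrained on non-composable pairs.\<close>

locale category =
  fixes C :: "('o, 'a) category_data"
  assumes Dom_in_Obj: "f \<in> Arr C \<Longrightarrow> Dom C f \<in> Obj C"
    and Cod_in_Obj: "f \<in> Arr C \<Longrightarrow> Cod C f \<in> Obj C"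
    and Id_in_hom: "x \<in> Obj C \<Longrightarrow> Id C x \<in> hom C x x"
    and Comp_in_hom: "f \<in> hom C x y \<Longrightarrow> g \<in> hom C y z \<Longrightarrow> Comp C g f \<in> hom C x z"
    and Comp_Id: "f \<in> hom C x y \<Longrightarrow> Comp C f (Id C x) = f"
    and Id_Comp: "f \<in> hom C x y \<Longrightarrow> Comp C (Id C y) f = f"
    and Comp_assoc: "f \<in> hom C w x \<Longrightarrow> g \<in> hom C x y \<Longrightarrow> h \<in> hom C y z \<Longrightarrow>
      Comp C h (Comp C g f) = Comp C (Comp C h g) f"

text \<open>
  \<open>is_pushout C f\<^sub>0 f\<^sub>1 g\<^sub>0 g\<^sub>1\<close>: the square \<open>g\<^sub>0 f\<^sub>0 = g\<^sub>1 f\<^sub>1\<close> is a pushout of \<open>f\<^sub>0\<close> and \<open>f\<^sub>1\<close>.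
  \<open>is_pullback C f\<^sub>0 f\<^sub>1 g\<^sub>0 g\<^sub>1\<close>: the square \<open>f\<^sub>0 g\<^sub>0 = f\<^sub>1 g\<^sub>1\<close> is a pullback of \<open>f\<^sub>0\<close> and \<open>f\<^sub>1\<close>.
\<close>

definition is_pushout :: "('o, 'a) category_data \<Rightarrow> 'a \<Rightarrow> 'a \<Rightarrow> 'a \<Rightarrow> 'a \<Rightarrow> bool" where
  "is_pushout C f\<^sub>0 f\<^sub>1 g\<^sub>0 g\<^sub>1 \<longleftrightarrow>
    (\<exists>x y\<^sub>0 y\<^sub>1 z. f\<^sub>0 \<in> hom C x y\<^sub>0 \<and> f\<^sub>1 \<in> hom C x y\<^sub>1 \<and> g\<^sub>0 \<in> hom C y\<^sub>0 z \<and> g\<^sub>1 \<in> hom C y\<^sub>1 z \<and>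
      Comp C g\<^sub>0 f\<^sub>0 = Comp C g\<^sub>1 f\<^sub>1 \<and>
      (\<forall>w \<in> Obj C. \<forall>k\<^sub>0 \<in> hom C y\<^sub>0 w. \<forall>k\<^sub>1 \<in> hom C y\<^sub>1 w. Comp C k\<^sub>0 f\<^sub>0 = Comp C k\<^sub>1 f\<^sub>1 \<longrightarrow>
        (\<exists>!k. k \<in> hom C z w \<and> Comp C k g\<^sub>0 = k\<^sub>0 \<and> Comp C k g\<^sub>1 = k\<^sub>1)))"

definition is_pullback :: "('o, 'a) category_data \<Rightarrow> 'a \<Rightarrow> 'a \<Rightarrow> 'a \<Rightarrow> 'a \<Rightarrow> bool" where
  "is_pullback C f\<^sub>0 f\<^sub>1 g\<^sub>0 g\<^sub>1 \<longleftrightarrow>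
    (\<exists>x y\<^sub>0 y\<^sub>1 z. f\<^sub>0 \<in> hom C y\<^sub>0 x \<and> f\<^sub>1 \<in> hom C y\<^sub>1 x \<and> g\<^sub>0 \<in> hom C z y\<^sub>0 \<and> g\<^sub>1 \<in> hom C z y\<^sub>1 \<and>
      Comp C f\<^sub>0 g\<^sub>0 = Comp C f\<^sub>1 g\<^sub>1 \<and>
      (\<forall>w \<in> Obj C. \<forall>k\<^sub>0 \<in> hom C w y\<^sub>0. \<forall>k\<^sub>1 \<in> hom C w y\<^sub>1. Comp C f\<^sub>0 k\<^sub>0 = Comp C f\<^sub>1 k\<^sub>1 \<longrightarrow>
        (\<exists>!k. k \<in> hom C w z \<and> Comp C g\<^sub>0 k = k\<^sub>0 \<and> Comp C g\<^sub>1 k = k\<^sub>1)))"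

text \<open>
  \<open>Cells1\<close> is the category of objects and 1-arrows. \<open>Cells2\<close> is the category whose objects are
  all 1-arrows and whose arrows are the 2-arrows under vertical composition, i.e. the disjoint
  union of the Hom-categories. \<open>HComp K \<beta> \<alpha>\<close> is horizontal composition, with \<open>\<alpha>\<close> applied first.
\<close>

record ('o, 'm, 'c) two_category_data =
  Cells1 :: "('o, 'm) category_data"
  Cells2 :: "('m, 'c) category_data"
  HComp :: "'c \<Rightarrow> 'c \<Rightarrow> 'c"

abbreviation Comp1 :: "('o, 'm, 'c) two_category_data \<Rightarrow> 'm \<Rightarrow> 'm \<Rightarrow> 'm" (infixr "\<odot>\<index>" 75)
  where "G \<odot>\<^bsub>K\<^esub> F \<equiv> Comp (Cells1 K) G F"

abbreviation Comp2 :: "('o, 'm, 'c) two_category_data \<Rightarrow> 'c \<Rightarrow> 'c \<Rightarrow> 'c" (infixr "\<bullet>\<index>" 70)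
  where "\<beta> \<bullet>\<^bsub>K\<^esub> \<alpha> \<equiv> Comp (Cells2 K) \<beta> \<alpha>"

abbreviation Id1 :: "('o, 'm, 'c) two_category_data \<Rightarrow> 'o \<Rightarrow> 'm" ("id1\<index>")
  where "id1\<^bsub>K\<^esub> X \<equiv> Id (Cells1 K) X"

abbreviation Id2 :: "('o, 'm, 'c) two_category_data \<Rightarrow> 'm \<Rightarrow> 'c" ("id2\<index>")
  where "id2\<^bsub>K\<^esub> F \<equiv> Id (Cells2 K) F"

locale strict_2_category =
  fixes K :: "('o, 'm, 'c) two_category_data" (structure)
  assumes category_Cells1: "category (Cells1 K)"
    and category_Cells2: "category (Cells2 K)"
    and Obj_Cells2: "Obj (Cells2 K) = Arr (Cells1 K)"
    and Dom_globular: "\<alpha> \<in> Arr (Cells2 K) \<Longrightarrow>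
      Dom (Cells1 K) (Dom (Cells2 K) \<alpha>) = Dom (Cells1 K) (Cod (Cells2 K) \<alpha>)"
    and Cod_globular: "\<alpha> \<in> Arr (Cells2 K) \<Longrightarrow>
      Cod (Cells1 K) (Dom (Cells2 K) \<alpha>) = Cod (Cells1 K) (Cod (Cells2 K) \<alpha>)"
    and HComp_in_hom: "F \<in> hom (Cells1 K) X Y \<Longrightarrow> G \<in> hom (Cells1 K) Y Z \<Longrightarrow>
      \<alpha> \<in> hom (Cells2 K) F F' \<Longrightarrow> \<beta> \<in> hom (Cells2 K) G G' \<Longrightarrow>
      HComp K \<beta> \<alpha> \<in> hom (Cells2 K) (G \<odot> F) (G' \<odot> F')"
    and HComp_id2: "F \<in> hom (Cells1 K) X Y \<Longrightarrow> G \<in> hom (Cells1 K) Y Z \<Longrightarrow>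
      HComp K (id2 G) (id2 F) = id2 (G \<odot> F)"
    and interchange: "F \<in> hom (Cells1 K) X Y \<Longrightarrow> G \<in> hom (Cells1 K) Y Z \<Longrightarrow>
      \<alpha> \<in> hom (Cells2 K) F F' \<Longrightarrow> \<alpha>' \<in> hom (Cells2 K) F' F'' \<Longrightarrow>
      \<beta> \<in> hom (Cells2 K) G G' \<Longrightarrow> \<beta>' \<in> hom (Cells2 K) G' G'' \<Longrightarrow>
      HComp K (\<beta>' \<bullet> \<beta>) (\<alpha>' \<bullet> \<alpha>) = HComp K \<beta>' \<alpha>' \<bullet> HComp K \<beta> \<alpha>"
    and HComp_assoc: "F \<in> hom (Cells1 K) W X \<Longrightarrow> G \<in> hom (Cells1 K) X Y \<Longrightarrow>
      H \<in> hom (Cells1 K) Y Z \<Longrightarrow>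
      \<alpha> \<in> hom (Cells2 K) F F' \<Longrightarrow> \<beta> \<in> hom (Cells2 K) G G' \<Longrightarrow> \<gamma> \<in> hom (Cells2 K) H H' \<Longrightarrow>
      HComp K \<gamma> (HComp K \<beta> \<alpha>) = HComp K (HComp K \<gamma> \<beta>) \<alpha>"
    and HComp_unit_right: "F \<in> hom (Cells1 K) X Y \<Longrightarrow> \<alpha> \<in> hom (Cells2 K) F F' \<Longrightarrow>
      HComp K \<alpha> (id2 (id1 X)) = \<alpha>"
    and HComp_unit_left: "F \<in> hom (Cells1 K) X Y \<Longrightarrow> \<alpha> \<in> hom (Cells2 K) F F' \<Longrightarrow>
      HComp K (id2 (id1 Y)) \<alpha> = \<alpha>"

text \<open>\<open>F \<triangleright> f\<close> is \<open>F(f)\<close> when \<open>f\<close> is an arrow of the source of \<open>F\<close>, and \<open>\<eta> \<triangleleft> a\<close> is \<open>\<eta>(a)\<close> when \<open>a\<close> is an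
  object of it; \<open>F(a)\<close> is \<open>F \<odot> a\<close>.\<close>

definition whisker_left :: "('o, 'm, 'c) two_category_data \<Rightarrow> 'm \<Rightarrow> 'c \<Rightarrow> 'c" (infixr "\<triangleright>\<index>" 75)
  where "F \<triangleright>\<^bsub>K\<^esub> \<alpha> = HComp K (id2\<^bsub>K\<^esub> F) \<alpha>"

definition whisker_right :: "('o, 'm, 'c) two_category_data \<Rightarrow> 'c \<Rightarrow> 'm \<Rightarrow> 'c" (infixl "\<triangleleft>\<index>" 75)
  where "\<alpha> \<triangleleft>\<^bsub>K\<^esub> F = HComp K \<alpha> (id2\<^bsub>K\<^esub> F)"

definition Hom :: "('o, 'm, 'c) two_category_data \<Rightarrow> 'o \<Rightarrow> 'o \<Rightarrow> ('m, 'c) category_data" where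
  "Hom K X Y =
    \<lparr>Obj = hom (Cells1 K) X Y,
     Arr = {\<alpha> \<in> Arr (Cells2 K).
       Dom (Cells2 K) \<alpha> \<in> hom (Cells1 K) X Y \<and> Cod (Cells2 K) \<alpha> \<in> hom (Cells1 K) X Y},
     Dom = Dom (Cells2 K),
     Cod = Cod (Cells2 K),
     Id = Id (Cells2 K),
     Comp = Comp (Cells2 K)\<rparr>"

lemma (in strict_2_category) category_Hom: "category (Hom K X Y)"
proof -
  interpret V: category "Cells2 K" by (rule category_Cells2)
  show ?thesis
  proof
    fix f x y g z
    assume "f \<in> hom (Hom K X Y) x y" "g \<in> hom (Hom K X Y) y z"
    then show "Comp (Hom K X Y) g f \<in> hom (Hom K X Y) x z"
      using V.Comp_in_hom[of f x y g z] by (auto simp: Hom_def hom_def)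
  next
    fix x assume "x \<in> Obj (Hom K X Y)"
    then show "Id (Hom K X Y) x \<in> hom (Hom K X Y) x x"
      using V.Id_in_hom[of x] Obj_Cells2 by (auto simp: Hom_def hom_def)
  next
    fix f w x g y h z
    assume "f \<in> hom (Hom K X Y) w x" "g \<in> hom (Hom K X Y) x y" "h \<in> hom (Hom K X Y) y z"
    then show "Comp (Hom K X Y) h (Comp (Hom K X Y) g f) = Comp (Hom K X Y) (Comp (Hom K X Y) h g) f"
      using V.Comp_assoc[of f w x g y h z] by (auto simp: Hom_def hom_def)
  qed (use V.Comp_Id V.Id_Comp in \<open>auto simp: Hom_def hom_def\<close>)
qed

text \<open>Final in the 2-categorical sense: every Hom-category into it is the terminal category.\<close>

definition is_final :: "('o, 'm, 'c) two_category_data \<Rightarrow> 'o \<Rightarrow> bool" where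
  "is_final K T \<longleftrightarrow> T \<in> Obj (Cells1 K) \<and>
    (\<forall>X \<in> Obj (Cells1 K). \<exists>t. Obj (Hom K X T) = {t} \<and> Arr (Hom K X T) = {id2\<^bsub>K\<^esub> t})"

text \<open>The category of objects and arrows of \<open>A\<close> is \<open>Hom K T A\<close>.\<close>

locale formal_category = strict_2_category K
  for K :: "('o, 'm, 'c) two_category_data" (structure) +
  fixes T :: 'o and A :: 'o
  assumes final: "is_final K T"
    and A_in_Obj: "A \<in> Obj (Cells1 K)"
    and eval_pushout: "A\<^sub>0 \<in> Obj (Cells1 K) \<Longrightarrow> A\<^sub>1 \<in> Obj (Cells1 K) \<Longrightarrow> a \<in> Obj (Hom K T A\<^sub>0) \<Longrightarrow>
      is_pushout (Hom K A\<^sub>0 A\<^sub>1) \<phi>\<^sub>0 \<phi>\<^sub>1 \<psi>\<^sub>0 \<psi>\<^sub>1 \<Longrightarrow>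
      is_pushout (Hom K T A\<^sub>1) (\<phi>\<^sub>0 \<triangleleft> a) (\<phi>\<^sub>1 \<triangleleft> a) (\<psi>\<^sub>0 \<triangleleft> a) (\<psi>\<^sub>1 \<triangleleft> a)"
    and eval_pullback: "A\<^sub>0 \<in> Obj (Cells1 K) \<Longrightarrow> A\<^sub>1 \<in> Obj (Cells1 K) \<Longrightarrow> a \<in> Obj (Hom K T A\<^sub>0) \<Longrightarrow>
      is_pullback (Hom K A\<^sub>0 A\<^sub>1) \<phi>\<^sub>0 \<phi>\<^sub>1 \<psi>\<^sub>0 \<psi>\<^sub>1 \<Longrightarrow>
      is_pullback (Hom K T A\<^sub>1) (\<phi>\<^sub>0 \<triangleleft> a) (\<phi>\<^sub>1 \<triangleleft> a) (\<psi>\<^sub>0 \<triangleleft> a) (\<psi>\<^sub>1 \<triangleleft> a)"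

definition is_cylinder ::
    "('o, 'm, 'c) two_category_data \<Rightarrow> 'o \<Rightarrow> 'm \<Rightarrow> 'c \<Rightarrow> 'c \<Rightarrow> bool" where
  "is_cylinder K A Cyl i\<^sub>0 i\<^sub>1 \<longleftrightarrow>
    Cyl \<in> Obj (Hom K A A) \<and>
    i\<^sub>0 \<in> hom (Hom K A A) (id1 A) Cyl \<and>
    i\<^sub>1 \<in> hom (Hom K A A) (id1 A) Cyl"
  for K (structure)

definition is_contraction ::
    "('o, 'm, 'c) two_category_data \<Rightarrow> 'o \<Rightarrow> 'm \<Rightarrow> 'c \<Rightarrow> 'c \<Rightarrow> 'c \<Rightarrow> bool" where
  "is_contraction K A Cyl i\<^sub>0 i\<^sub>1 p \<longleftrightarrow>
    p \<in> hom (Hom K A A) Cyl (id1 A) \<and>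
    p \<bullet> i\<^sub>0 = id2 (id1 A) \<and>
    p \<bullet> i\<^sub>1 = id2 (id1 A)"
  for K (structure)

definition is_involution ::
    "('o, 'm, 'c) two_category_data \<Rightarrow> 'o \<Rightarrow> 'm \<Rightarrow> 'c \<Rightarrow> 'c \<Rightarrow> 'c \<Rightarrow> bool" where
  "is_involution K A Cyl i\<^sub>0 i\<^sub>1 v \<longleftrightarrow>
    v \<in> hom (Hom K A A) Cyl Cyl \<and> v \<bullet> i\<^sub>0 = i\<^sub>1 \<and> v \<bullet> i\<^sub>1 = i\<^sub>0"
  for K (structure)

definition involution_compatible ::
    "('o, 'm, 'c) two_category_data \<Rightarrow> 'c \<Rightarrow> 'c \<Rightarrow> bool" where
  "involution_compatible K p v \<longleftrightarrow> p \<bullet> v = p"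
  for K (structure)

definition is_subdivision ::
    "('o, 'm, 'c) two_category_data \<Rightarrow> 'o \<Rightarrow> 'm \<Rightarrow> 'c \<Rightarrow> 'c \<Rightarrow> 'm \<Rightarrow> 'c \<Rightarrow> 'c \<Rightarrow> 'c \<Rightarrow> bool" where
  "is_subdivision K A Cyl i\<^sub>0 i\<^sub>1 S r\<^sub>0 r\<^sub>1 s \<longleftrightarrow>
    S \<in> Obj (Hom K A A) \<and>
    r\<^sub>0 \<in> hom (Hom K A A) Cyl S \<and>
    r\<^sub>1 \<in> hom (Hom K A A) Cyl S \<and>
    is_pushout (Hom K A A) i\<^sub>0 i\<^sub>1 r\<^sub>0 r\<^sub>1 \<and>
    s \<in> hom (Hom K A A) Cyl S \<and>
    s \<bullet> i\<^sub>0 = r\<^sub>1 \<bullet> i\<^sub>0 \<and>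
    s \<bullet> i\<^sub>1 = r\<^sub>0 \<bullet> i\<^sub>1"
  for K (structure)

text \<open>The 2-arrow from \<open>S\<close> to the identity that restricts to \<open>p\<close> along \<open>r\<^sub>0\<close> and \<open>r\<^sub>1\<close>; the pushout
  property and \<open>p i\<^sub>0 = p i\<^sub>1\<close> make it exist uniquely.\<close>

definition p_bar ::
    "('o, 'm, 'c) two_category_data \<Rightarrow> 'o \<Rightarrow> 'c \<Rightarrow> 'm \<Rightarrow> 'c \<Rightarrow> 'c \<Rightarrow> 'c" where
  "p_bar K A p S r\<^sub>0 r\<^sub>1 =
    (THE q. q \<in> hom (Hom K A A) S (id1 A) \<and> q \<bullet> r\<^sub>0 = p \<and> q \<bullet> r\<^sub>1 = p)"
  for K (structure)

definition subdivision_compatible ::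
    "('o, 'm, 'c) two_category_data \<Rightarrow> 'o \<Rightarrow> 'c \<Rightarrow> 'm \<Rightarrow> 'c \<Rightarrow> 'c \<Rightarrow> 'c \<Rightarrow> bool" where
  "subdivision_compatible K A p S r\<^sub>0 r\<^sub>1 s \<longleftrightarrow> p_bar K A p S r\<^sub>0 r\<^sub>1 \<bullet> s = p"
  for K (structure)

definition is_upper_left_connection ::
    "('o, 'm, 'c) two_category_data \<Rightarrow> 'o \<Rightarrow> 'm \<Rightarrow> 'c \<Rightarrow> 'c \<Rightarrow> 'c \<Rightarrow> 'c \<Rightarrow> bool" where
  "is_upper_left_connection K A Cyl i\<^sub>0 i\<^sub>1 p \<Gamma> \<longleftrightarrow>
    \<Gamma> \<in> hom (Hom K A A) (Cyl \<odot> Cyl) Cyl \<and>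
    \<Gamma> \<bullet> (i\<^sub>0 \<triangleleft> Cyl) = id2 Cyl \<and>
    \<Gamma> \<bullet> (Cyl \<triangleright> i\<^sub>0) = id2 Cyl \<and>
    \<Gamma> \<bullet> (i\<^sub>1 \<triangleleft> Cyl) = i\<^sub>1 \<bullet> p \<and>
    \<Gamma> \<bullet> (Cyl \<triangleright> i\<^sub>1) = i\<^sub>1 \<bullet> p"
  for K (structure)

definition preserves_subdivision ::
    "('o, 'm, 'c) two_category_data \<Rightarrow> 'o \<Rightarrow> 'm \<Rightarrow> 'c \<Rightarrow> 'c \<Rightarrow> 'c \<Rightarrow> 'c \<Rightarrow> bool" where
  "preserves_subdivision K A Cyl i\<^sub>0 i\<^sub>1 r\<^sub>0 r\<^sub>1 \<longleftrightarrow>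
    is_pushout (Hom K A A) (Cyl \<triangleright> i\<^sub>0) (Cyl \<triangleright> i\<^sub>1) (Cyl \<triangleright> r\<^sub>0) (Cyl \<triangleright> r\<^sub>1)"
  for K (structure)

definition is_homotopy ::
    "('o, 'm, 'c) two_category_data \<Rightarrow> 'o \<Rightarrow> 'o \<Rightarrow> 'm \<Rightarrow> 'c \<Rightarrow> 'c \<Rightarrow>
     'm \<Rightarrow> 'm \<Rightarrow> 'c \<Rightarrow> 'c \<Rightarrow> 'c \<Rightarrow> bool" where
  "is_homotopy K T A Cyl i\<^sub>0 i\<^sub>1 a\<^sub>0 a\<^sub>1 f\<^sub>0 f\<^sub>1 h \<longleftrightarrow>
    f\<^sub>0 \<in> hom (Hom K T A) a\<^sub>0 a\<^sub>1 \<and>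
    f\<^sub>1 \<in> hom (Hom K T A) a\<^sub>0 a\<^sub>1 \<and>
    h \<in> hom (Hom K T A) (Cyl \<odot> a\<^sub>0) a\<^sub>1 \<and>
    h \<bullet> (i\<^sub>0 \<triangleleft> a\<^sub>0) = f\<^sub>0 \<and>
    h \<bullet> (i\<^sub>1 \<triangleleft> a\<^sub>0) = f\<^sub>1"
  for K (structure)

definition is_homotopy_equivalence ::
    "('o, 'm, 'c) two_category_data \<Rightarrow> 'o \<Rightarrow> 'o \<Rightarrow> 'm \<Rightarrow> 'c \<Rightarrow> 'c \<Rightarrow>
     'm \<Rightarrow> 'm \<Rightarrow> 'c \<Rightarrow> bool" where
  "is_homotopy_equivalence K T A Cyl i\<^sub>0 i\<^sub>1 a\<^sub>0 a\<^sub>1 f \<longleftrightarrow>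
    f \<in> hom (Hom K T A) a\<^sub>0 a\<^sub>1 \<and>
    (\<exists>g \<in> hom (Hom K T A) a\<^sub>1 a\<^sub>0.
      (\<exists>h. is_homotopy K T A Cyl i\<^sub>0 i\<^sub>1 a\<^sub>0 a\<^sub>0 (g \<bullet> f) (id2 a\<^sub>0) h) \<and>
      (\<exists>h. is_homotopy K T A Cyl i\<^sub>0 i\<^sub>1 a\<^sub>1 a\<^sub>1 (f \<bullet> g) (id2 a\<^sub>1) h))"
  for K (structure)

definition is_homotopy_over ::
    "('o, 'm, 'c) two_category_data \<Rightarrow> 'o \<Rightarrow> 'o \<Rightarrow> 'm \<Rightarrow> 'c \<Rightarrow> 'c \<Rightarrow> 'c \<Rightarrow>
     'm \<Rightarrow> 'm \<Rightarrow> 'm \<Rightarrow> 'c \<Rightarrow> 'c \<Rightarrow> 'c \<Rightarrow> 'c \<Rightarrow> 'c \<Rightarrow> bool" where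
  "is_homotopy_over K T A Cyl i\<^sub>0 i\<^sub>1 p a a\<^sub>0 a\<^sub>1 j\<^sub>0 j\<^sub>1 f\<^sub>0 f\<^sub>1 h \<longleftrightarrow>
    j\<^sub>0 \<in> hom (Hom K T A) a\<^sub>0 a \<and>
    j\<^sub>1 \<in> hom (Hom K T A) a\<^sub>1 a \<and>
    j\<^sub>1 \<bullet> f\<^sub>0 = j\<^sub>0 \<and>
    j\<^sub>1 \<bullet> f\<^sub>1 = j\<^sub>0 \<and>
    is_homotopy K T A Cyl i\<^sub>0 i\<^sub>1 a\<^sub>0 a\<^sub>1 f\<^sub>0 f\<^sub>1 h \<and>
    j\<^sub>1 \<bullet> h = (p \<triangleleft> a) \<bullet> (Cyl \<triangleright> j\<^sub>0)"
  for K (structure)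

definition is_homotopy_equivalence_over ::
    "('o, 'm, 'c) two_category_data \<Rightarrow> 'o \<Rightarrow> 'o \<Rightarrow> 'm \<Rightarrow> 'c \<Rightarrow> 'c \<Rightarrow> 'c \<Rightarrow>
     'm \<Rightarrow> 'm \<Rightarrow> 'm \<Rightarrow> 'c \<Rightarrow> 'c \<Rightarrow> 'c \<Rightarrow> bool" where
  "is_homotopy_equivalence_over K T A Cyl i\<^sub>0 i\<^sub>1 p a a\<^sub>0 a\<^sub>1 j\<^sub>0 j\<^sub>1 f \<longleftrightarrow>
    j\<^sub>0 \<in> hom (Hom K T A) a\<^sub>0 a \<and>
    j\<^sub>1 \<in> hom (Hom K T A) a\<^sub>1 a \<and>
    f \<in> hom (Hom K T A) a\<^sub>0 a\<^sub>1 \<and>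
    j\<^sub>1 \<bullet> f = j\<^sub>0 \<and>
    (\<exists>g \<in> hom (Hom K T A) a\<^sub>1 a\<^sub>0.
      j\<^sub>0 \<bullet> g = j\<^sub>1 \<and>
      (\<exists>h. is_homotopy_over K T A Cyl i\<^sub>0 i\<^sub>1 p a a\<^sub>0 a\<^sub>0 j\<^sub>0 j\<^sub>0 (g \<bullet> f) (id2 a\<^sub>0) h) \<and>
      (\<exists>h. is_homotopy_over K T A Cyl i\<^sub>0 i\<^sub>1 p a a\<^sub>1 a\<^sub>1 j\<^sub>1 j\<^sub>1 (f \<bullet> g) (id2 a\<^sub>1) h))"
  for K (structure)

definition is_fibration ::
    "('o, 'm, 'c) two_category_data \<Rightarrow> 'o \<Rightarrow> 'o \<Rightarrow> 'm \<Rightarrow> 'c \<Rightarrow> 'm \<Rightarrow> 'm \<Rightarrow> 'c \<Rightarrow> bool" where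
  "is_fibration K T A Cyl i\<^sub>0 a\<^sub>1 a\<^sub>2 f \<longleftrightarrow>
    f \<in> hom (Hom K T A) a\<^sub>1 a\<^sub>2 \<and>
    (\<forall>a\<^sub>0 \<in> Obj (Hom K T A).
      \<forall>g \<in> hom (Hom K T A) a\<^sub>0 a\<^sub>1. \<forall>h \<in> hom (Hom K T A) (Cyl \<odot> a\<^sub>0) a\<^sub>2.
        h \<bullet> (i\<^sub>0 \<triangleleft> a\<^sub>0) = f \<bullet> g \<longrightarrow>
        (\<exists>l \<in> hom (Hom K T A) (Cyl \<odot> a\<^sub>0) a\<^sub>1. l \<bullet> (i\<^sub>0 \<triangleleft> a\<^sub>0) = g \<and> f \<bullet> l = h))"
  for K (structure)

end

theory Submission
  imports Defs
begin

text \<open>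
  The argument is Dold's, arranged so that only the homotopy lifting property of a fibration is
  ever used, never lifting relative to a prescribed boundary.

  Let \<open>g\<close> be a homotopy inverse of \<open>f\<close>, and \<open>h\<close> a homotopy from \<open>f g\<close> to the identity. The homotopy
  \<open>k = j\<^sub>1 h\<close> runs from \<open>j\<^sub>0 g\<close> to \<open>j\<^sub>1\<close>; lifting it along \<open>j\<^sub>0\<close> with start \<open>g\<close> yields \<open>l\<close>, whose end
  \<open>F\<close> lies over \<open>a\<close>. The reverse of \<open>f l\<close> followed by \<open>h\<close> is a homotopy from \<open>f F\<close> to the identity.
  It need not be over \<open>a\<close>: its image in \<open>a\<close> is the loop that runs through \<open>k\<close> backwards and then
  forwards. But such a loop is null homotopic relative to its ends: on the second half use
  \<open>k \<Gamma>\<close>, on the first half \<open>k \<Gamma> Cyl(v)\<close>, and glue, which is possible because \<open>Cyl\<close> preserves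
  the subdivision pushout (\<open>null_homotopy\<close>). Lift this null homotopy along \<open>j\<^sub>1\<close>, fixing only its
  initial face. The three other faces of the lift have constant image in \<open>a\<close>, so their
  composite joins \<open>f F\<close> to the identity over \<open>a\<close> (\<open>ends_homotopic_over\<close>).

  So \<open>f\<close> has a right inverse \<open>F\<close> up to homotopy over \<open>a\<close> (\<open>right_inverse_over\<close>). As \<open>f\<close> also has a
  homotopy left inverse, \<open>F f\<close> is homotopic to the identity, so the same result applies to \<open>F\<close> and
  gives \<open>G\<close> with \<open>F G\<close> homotopic to the identity over \<open>a\<close>. The usual cancellation of inverses,
  carried out over \<open>a\<close>, then makes \<open>F\<close> a two-sided inverse (\<open>homotopy_inverse_over\<close>).

  The argument takes place in an ordinary category with an endofunctor and natural transformations.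
  Evaluation at the objects of \<open>A\<close> provides these, the interchange law being what makes the
  evaluated 2-arrows natural (\<open>cylinder_category_evaluation\<close>).
\<close>

section \<open>Ordinary categories with a structured cylinder\<close>

context category
begin

text \<open>Rewriting inside a composite: associativity holds only for typed arrows, so each rewriting
  step carries the typing of the three factors.\<close>

lemma Comp_subst_right:
  assumes "f \<in> hom C w x" "g \<in> hom C x y" "h \<in> hom C y z" "Comp C g f = e"
  shows "Comp C (Comp C h g) f = Comp C h e"
  using Comp_assoc[OF assms(1-3)] assms(4) by simp

lemma homD: "f \<in> hom C x y \<Longrightarrow> x \<in> Obj C" "f \<in> hom C x y \<Longrightarrow> y \<in> Obj C"
  using Dom_in_Obj Cod_in_Obj by (auto simp: hom_def)

end

lemma hom_unique:
  "f \<in> hom C x y \<Longrightarrow> f \<in> hom C x' y' \<Longrightarrow> x' = x \<and> y' = y"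
  by (auto simp: hom_def)

text \<open>The corners are existentially quantified in the definition of a pushout; the types of the
  two legs into the pushout determine them.\<close>

lemma is_pushoutD:
  assumes "is_pushout C f\<^sub>0 f\<^sub>1 g\<^sub>0 g\<^sub>1" "g\<^sub>0 \<in> hom C y\<^sub>0 z" "g\<^sub>1 \<in> hom C y\<^sub>1 z"
    and "w \<in> Obj C" "k\<^sub>0 \<in> hom C y\<^sub>0 w" "k\<^sub>1 \<in> hom C y\<^sub>1 w" "Comp C k\<^sub>0 f\<^sub>0 = Comp C k\<^sub>1 f\<^sub>1"
  shows "\<exists>!k. k \<in> hom C z w \<and> Comp C k g\<^sub>0 = k\<^sub>0 \<and> Comp C k g\<^sub>1 = k\<^sub>1"
proof -
  from assms(1) obtain x' y\<^sub>0' y\<^sub>1' z' where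
    g: "g\<^sub>0 \<in> hom C y\<^sub>0' z'" "g\<^sub>1 \<in> hom C y\<^sub>1' z'"
    and u: "\<forall>w \<in> Obj C. \<forall>k\<^sub>0 \<in> hom C y\<^sub>0' w. \<forall>k\<^sub>1 \<in> hom C y\<^sub>1' w.
        Comp C k\<^sub>0 f\<^sub>0 = Comp C k\<^sub>1 f\<^sub>1 \<longrightarrow>
        (\<exists>!k. k \<in> hom C z' w \<and> Comp C k g\<^sub>0 = k\<^sub>0 \<and> Comp C k g\<^sub>1 = k\<^sub>1)"
    unfolding is_pushout_def by blast
  have "y\<^sub>0' = y\<^sub>0" "y\<^sub>1' = y\<^sub>1" "z' = z"
    using hom_unique[OF assms(2) g(1)] hom_unique[OF assms(3) g(2)] by auto
  with u assms(4-7) show ?thesis by blast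
qed

text \<open>
  \<open>C\<close> and \<open>C'\<close> are the object and arrow parts of the cylinder functor. \<open>S\<close> is the subdivided
  cylinder, with \<open>r\<^sub>1\<close> its first and \<open>r\<^sub>0\<close> its second half, and \<open>p'\<close> is the map from it to the
  base induced by \<open>p\<close> on both halves.
\<close>

locale cylinder_category = category D
  for D :: "('o, 'a) category_data" +
  fixes C S :: "'o \<Rightarrow> 'o" and C' :: "'a \<Rightarrow> 'a"
    and i\<^sub>0 i\<^sub>1 p v \<Gamma> r\<^sub>0 r\<^sub>1 s p' :: "'o \<Rightarrow> 'a"
  assumes C'_hom: "f \<in> hom D x y \<Longrightarrow> C' f \<in> hom D (C x) (C y)"
    and C'_Comp: "f \<in> hom D x y \<Longrightarrow> g \<in> hom D y z \<Longrightarrow> C' (Comp D g f) = Comp D (C' g) (C' f)"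
    and i\<^sub>0_hom: "x \<in> Obj D \<Longrightarrow> i\<^sub>0 x \<in> hom D x (C x)"
    and i\<^sub>1_hom: "x \<in> Obj D \<Longrightarrow> i\<^sub>1 x \<in> hom D x (C x)"
    and i\<^sub>0_nat: "f \<in> hom D x y \<Longrightarrow> Comp D (C' f) (i\<^sub>0 x) = Comp D (i\<^sub>0 y) f"
    and i\<^sub>1_nat: "f \<in> hom D x y \<Longrightarrow> Comp D (C' f) (i\<^sub>1 x) = Comp D (i\<^sub>1 y) f"
    and p_hom: "x \<in> Obj D \<Longrightarrow> p x \<in> hom D (C x) x"
    and p_nat: "f \<in> hom D x y \<Longrightarrow> Comp D (p y) (C' f) = Comp D f (p x)"
    and p_i\<^sub>0: "x \<in> Obj D \<Longrightarrow> Comp D (p x) (i\<^sub>0 x) = Id D x"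
    and p_i\<^sub>1: "x \<in> Obj D \<Longrightarrow> Comp D (p x) (i\<^sub>1 x) = Id D x"
    and v_hom: "x \<in> Obj D \<Longrightarrow> v x \<in> hom D (C x) (C x)"
    and v_i\<^sub>0: "x \<in> Obj D \<Longrightarrow> Comp D (v x) (i\<^sub>0 x) = i\<^sub>1 x"
    and v_i\<^sub>1: "x \<in> Obj D \<Longrightarrow> Comp D (v x) (i\<^sub>1 x) = i\<^sub>0 x"
    and p_v: "x \<in> Obj D \<Longrightarrow> Comp D (p x) (v x) = p x"
    and \<Gamma>_hom: "x \<in> Obj D \<Longrightarrow> \<Gamma> x \<in> hom D (C (C x)) (C x)"
    and \<Gamma>_i\<^sub>0: "x \<in> Obj D \<Longrightarrow> Comp D (\<Gamma> x) (i\<^sub>0 (C x)) = Id D (C x)"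
    and \<Gamma>_C'_i\<^sub>0: "x \<in> Obj D \<Longrightarrow> Comp D (\<Gamma> x) (C' (i\<^sub>0 x)) = Id D (C x)"
    and \<Gamma>_i\<^sub>1: "x \<in> Obj D \<Longrightarrow> Comp D (\<Gamma> x) (i\<^sub>1 (C x)) = Comp D (i\<^sub>1 x) (p x)"
    and \<Gamma>_C'_i\<^sub>1: "x \<in> Obj D \<Longrightarrow> Comp D (\<Gamma> x) (C' (i\<^sub>1 x)) = Comp D (i\<^sub>1 x) (p x)"
    and r\<^sub>0_hom: "x \<in> Obj D \<Longrightarrow> r\<^sub>0 x \<in> hom D (C x) (S x)"
    and r\<^sub>1_hom: "x \<in> Obj D \<Longrightarrow> r\<^sub>1 x \<in> hom D (C x) (S x)"
    and pushout: "x \<in> Obj D \<Longrightarrow> is_pushout D (i\<^sub>0 x) (i\<^sub>1 x) (r\<^sub>0 x) (r\<^sub>1 x)"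
    and C'_pushout: "x \<in> Obj D \<Longrightarrow>
      is_pushout D (C' (i\<^sub>0 x)) (C' (i\<^sub>1 x)) (C' (r\<^sub>0 x)) (C' (r\<^sub>1 x))"
    and s_hom: "x \<in> Obj D \<Longrightarrow> s x \<in> hom D (C x) (S x)"
    and s_i\<^sub>0: "x \<in> Obj D \<Longrightarrow> Comp D (s x) (i\<^sub>0 x) = Comp D (r\<^sub>1 x) (i\<^sub>0 x)"
    and s_i\<^sub>1: "x \<in> Obj D \<Longrightarrow> Comp D (s x) (i\<^sub>1 x) = Comp D (r\<^sub>0 x) (i\<^sub>1 x)"
    and p'_hom: "x \<in> Obj D \<Longrightarrow> p' x \<in> hom D (S x) x"
    and p'_r\<^sub>0: "x \<in> Obj D \<Longrightarrow> Comp D (p' x) (r\<^sub>0 x) = p x"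
    and p'_r\<^sub>1: "x \<in> Obj D \<Longrightarrow> Comp D (p' x) (r\<^sub>1 x) = p x"
    and p'_s: "x \<in> Obj D \<Longrightarrow> Comp D (p' x) (s x) = p x"
begin

abbreviation comp (infixr "\<cdot>" 70) where "g \<cdot> f \<equiv> Comp D g f"

lemma C_Obj: "x \<in> Obj D \<Longrightarrow> C x \<in> Obj D"
  using homD(2)[OF i\<^sub>0_hom] .

lemma S_Obj: "x \<in> Obj D \<Longrightarrow> S x \<in> Obj D"
  using homD(2)[OF r\<^sub>0_hom] .

lemma S_glue:
  assumes "x \<in> Obj D" "m\<^sub>0 \<in> hom D (C x) y" "m\<^sub>1 \<in> hom D (C x) y" "m\<^sub>0 \<cdot> i\<^sub>0 x = m\<^sub>1 \<cdot> i\<^sub>1 x"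
  obtains m where "m \<in> hom D (S x) y" "m \<cdot> r\<^sub>0 x = m\<^sub>0" "m \<cdot> r\<^sub>1 x = m\<^sub>1"
  using is_pushoutD[OF pushout[OF assms(1)] r\<^sub>0_hom[OF assms(1)] r\<^sub>1_hom[OF assms(1)]
      homD(2)[OF assms(2)] assms(2-4)] by blast

lemma pushout_square:
  "x \<in> Obj D \<Longrightarrow> r\<^sub>0 x \<cdot> i\<^sub>0 x = r\<^sub>1 x \<cdot> i\<^sub>1 x"
  using pushout by (auto simp: is_pushout_def)

lemma S_ext:
  assumes x: "x \<in> Obj D" and m: "m \<in> hom D (S x) y" "m' \<in> hom D (S x) y"
    and eq: "m \<cdot> r\<^sub>0 x = m' \<cdot> r\<^sub>0 x" "m \<cdot> r\<^sub>1 x = m' \<cdot> r\<^sub>1 x"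
  shows "m = m'"
proof -
  have "(m \<cdot> r\<^sub>0 x) \<cdot> i\<^sub>0 x = (m \<cdot> r\<^sub>1 x) \<cdot> i\<^sub>1 x"
    using x m pushout_square[OF x] Comp_assoc i\<^sub>0_hom i\<^sub>1_hom r\<^sub>0_hom r\<^sub>1_hom by metis
  then show ?thesis
    using is_pushoutD[OF pushout[OF x] r\<^sub>0_hom[OF x] r\<^sub>1_hom[OF x] homD(2)[OF m(1)]
        Comp_in_hom[OF r\<^sub>0_hom[OF x] m(1)] Comp_in_hom[OF r\<^sub>1_hom[OF x] m(1)]] m eq
    by metis
qed

lemma C'_S_glue:
  assumes x: "x \<in> Obj D" and m: "m\<^sub>0 \<in> hom D (C (C x)) y" "m\<^sub>1 \<in> hom D (C (C x)) y"
    "m\<^sub>0 \<cdot> C' (i\<^sub>0 x) = m\<^sub>1 \<cdot> C' (i\<^sub>1 x)"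
  obtains m where "m \<in> hom D (C (S x)) y" "m \<cdot> C' (r\<^sub>0 x) = m\<^sub>0" "m \<cdot> C' (r\<^sub>1 x) = m\<^sub>1"
  using is_pushoutD[OF C'_pushout[OF x] C'_hom[OF r\<^sub>0_hom[OF x]] C'_hom[OF r\<^sub>1_hom[OF x]]
      homD(2)[OF m(1)] m] by blast

section \<open>Homotopies stationary along a set of arrows\<close>

text \<open>The homotopy becomes constant after composition with each arrow in \<open>W\<close>. The case \<open>W = {}\<close>
  is plain homotopy and \<open>W = {j}\<close> is homotopy over the target of \<open>j\<close>, so that both relations
  share one proof of symmetry, transitivity and compatibility with composition.\<close>

definition homotopic :: "'a set \<Rightarrow> 'o \<Rightarrow> 'o \<Rightarrow> 'a \<Rightarrow> 'a \<Rightarrow> bool" where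
  "homotopic W x y f\<^sub>0 f\<^sub>1 \<longleftrightarrow> x \<in> Obj D \<and>
    (\<exists>h \<in> hom D (C x) y. h \<cdot> i\<^sub>0 x = f\<^sub>0 \<and> h \<cdot> i\<^sub>1 x = f\<^sub>1 \<and>
      (\<forall>q \<in> W. \<exists>z. q \<in> hom D y z \<and> q \<cdot> h = (q \<cdot> f\<^sub>0) \<cdot> p x))"

lemma homotopic_ends:
  assumes "homotopic W x y f\<^sub>0 f\<^sub>1" "q \<in> W"
  shows "q \<cdot> f\<^sub>0 = q \<cdot> f\<^sub>1"
proof -
  from assms obtain h z where h: "h \<in> hom D (C x) y" "h \<cdot> i\<^sub>0 x = f\<^sub>0" "h \<cdot> i\<^sub>1 x = f\<^sub>1"
    "q \<in> hom D y z" "q \<cdot> h = (q \<cdot> f\<^sub>0) \<cdot> p x" and x: "x \<in> Obj D"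
    unfolding homotopic_def by blast
  have f\<^sub>0: "f\<^sub>0 \<in> hom D x y" using h(1,2) i\<^sub>0_hom[OF x] Comp_in_hom by blast
  have qf\<^sub>0: "q \<cdot> f\<^sub>0 \<in> hom D x z" using f\<^sub>0 h(4) Comp_in_hom by blast
  have "q \<cdot> f\<^sub>1 = (q \<cdot> h) \<cdot> i\<^sub>1 x"
    using Comp_subst_right[OF i\<^sub>1_hom[OF x] h(1) h(4) h(3)] by simp
  also have "\<dots> = (q \<cdot> f\<^sub>0) \<cdot> Id D x"
    unfolding h(5) using Comp_subst_right[OF i\<^sub>1_hom[OF x] p_hom[OF x] qf\<^sub>0 p_i\<^sub>1[OF x]] .
  finally show ?thesis using Comp_Id[OF qf\<^sub>0] by simp
qed

lemma homotopic_hom: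
  assumes "homotopic W x y f\<^sub>0 f\<^sub>1"
  shows "f\<^sub>0 \<in> hom D x y" "f\<^sub>1 \<in> hom D x y"
  using assms Comp_in_hom i\<^sub>0_hom i\<^sub>1_hom unfolding homotopic_def by blast+

text \<open>Compose with the involution \<open>v\<close>; since \<open>p v = p\<close>, constant homotopies reverse to constant
  ones.\<close>

lemma homotopic_sym:
  assumes H: "homotopic W x y f\<^sub>0 f\<^sub>1"
  shows "homotopic W x y f\<^sub>1 f\<^sub>0"
proof -
  from H obtain h where h: "h \<in> hom D (C x) y" "h \<cdot> i\<^sub>0 x = f\<^sub>0" "h \<cdot> i\<^sub>1 x = f\<^sub>1"
    and W: "\<And>q. q \<in> W \<Longrightarrow> \<exists>z. q \<in> hom D y z \<and> q \<cdot> h = (q \<cdot> f\<^sub>0) \<cdot> p x" and x: "x \<in> Obj D"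
    unfolding homotopic_def by blast
  have v: "v x \<in> hom D (C x) (C x)" by (rule v_hom[OF x])
  have "\<exists>z. q \<in> hom D y z \<and> q \<cdot> h \<cdot> v x = (q \<cdot> f\<^sub>1) \<cdot> p x" if q: "q \<in> W" for q
  proof -
    from W[OF q] obtain z where z: "q \<in> hom D y z" "q \<cdot> h = (q \<cdot> f\<^sub>0) \<cdot> p x" by blast
    have "q \<cdot> h \<cdot> v x = ((q \<cdot> f\<^sub>0) \<cdot> p x) \<cdot> v x"
      using Comp_assoc[OF v h(1) z(1)] z(2) by simp
    also have "\<dots> = (q \<cdot> f\<^sub>0) \<cdot> p x"
      using Comp_subst_right[OF v p_hom[OF x] Comp_in_hom[OF homotopic_hom(1)[OF H] z(1)] p_v[OF x]] .
    finally show ?thesis using z(1) homotopic_ends[OF H q] by auto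
  qed
  moreover have "(h \<cdot> v x) \<cdot> i\<^sub>0 x = f\<^sub>1"
    using Comp_subst_right[OF i\<^sub>0_hom[OF x] v h(1) v_i\<^sub>0[OF x]] h(3) by simp
  moreover have "(h \<cdot> v x) \<cdot> i\<^sub>1 x = f\<^sub>0"
    using Comp_subst_right[OF i\<^sub>1_hom[OF x] v h(1) v_i\<^sub>1[OF x]] h(2) by simp
  ultimately show ?thesis
    unfolding homotopic_def using Comp_in_hom[OF v h(1)] x by blast
qed

text \<open>Glue the two homotopies along \<open>S\<close> and restrict along \<open>s\<close>. Two constant homotopies at the
  same arrow glue to that arrow composed with \<open>p'\<close>, and \<open>p' s = p\<close> makes the composite constant.\<close>

lemma homotopic_trans:
  assumes H: "homotopic W x y f\<^sub>0 f\<^sub>1" and H': "homotopic W x y f\<^sub>1 f\<^sub>2"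
  shows "homotopic W x y f\<^sub>0 f\<^sub>2"
proof -
  from H obtain h where h: "h \<in> hom D (C x) y" "h \<cdot> i\<^sub>0 x = f\<^sub>0" "h \<cdot> i\<^sub>1 x = f\<^sub>1"
    and W: "\<And>q. q \<in> W \<Longrightarrow> \<exists>z. q \<in> hom D y z \<and> q \<cdot> h = (q \<cdot> f\<^sub>0) \<cdot> p x" and x: "x \<in> Obj D"
    unfolding homotopic_def by blast
  from H' obtain h' where h': "h' \<in> hom D (C x) y" "h' \<cdot> i\<^sub>0 x = f\<^sub>1" "h' \<cdot> i\<^sub>1 x = f\<^sub>2"
    and W': "\<And>q. q \<in> W \<Longrightarrow> q \<cdot> h' = (q \<cdot> f\<^sub>1) \<cdot> p x"
    unfolding homotopic_def by blast
  have "h' \<cdot> i\<^sub>0 x = h \<cdot> i\<^sub>1 x" using h h' by simp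
  then obtain m where m: "m \<in> hom D (S x) y" "m \<cdot> r\<^sub>0 x = h'" "m \<cdot> r\<^sub>1 x = h"
    using S_glue[OF x h'(1) h(1)] by blast
  have s: "s x \<in> hom D (C x) (S x)" by (rule s_hom[OF x])
  have "(m \<cdot> s x) \<cdot> i\<^sub>0 x = f\<^sub>0"
    using Comp_subst_right[OF i\<^sub>0_hom[OF x] s m(1) s_i\<^sub>0[OF x]]
      Comp_assoc[OF i\<^sub>0_hom[OF x] r\<^sub>1_hom[OF x] m(1)] m(3) h(2) by simp
  moreover have "(m \<cdot> s x) \<cdot> i\<^sub>1 x = f\<^sub>2"
    using Comp_subst_right[OF i\<^sub>1_hom[OF x] s m(1) s_i\<^sub>1[OF x]]
      Comp_assoc[OF i\<^sub>1_hom[OF x] r\<^sub>0_hom[OF x] m(1)] m(2) h'(3) by simp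
  moreover have "\<exists>z. q \<in> hom D y z \<and> q \<cdot> m \<cdot> s x = (q \<cdot> f\<^sub>0) \<cdot> p x" if q: "q \<in> W" for q
  proof -
    from W[OF q] obtain z where z: "q \<in> hom D y z" "q \<cdot> h = (q \<cdot> f\<^sub>0) \<cdot> p x" by blast
    have z': "q \<cdot> h' = (q \<cdot> f\<^sub>0) \<cdot> p x" using W'[OF q] homotopic_ends[OF H q] by simp
    have qf\<^sub>0: "q \<cdot> f\<^sub>0 \<in> hom D x z" using Comp_in_hom[OF homotopic_hom(1)[OF H] z(1)] .
    have "q \<cdot> m = (q \<cdot> f\<^sub>0) \<cdot> p' x"
    proof (rule S_ext[OF x])
      show "(q \<cdot> m) \<cdot> r\<^sub>0 x = ((q \<cdot> f\<^sub>0) \<cdot> p' x) \<cdot> r\<^sub>0 x"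
        using Comp_subst_right[OF r\<^sub>0_hom[OF x] m(1) z(1) m(2)] z'
          Comp_subst_right[OF r\<^sub>0_hom[OF x] p'_hom[OF x] qf\<^sub>0 p'_r\<^sub>0[OF x]] by simp
      show "(q \<cdot> m) \<cdot> r\<^sub>1 x = ((q \<cdot> f\<^sub>0) \<cdot> p' x) \<cdot> r\<^sub>1 x"
        using Comp_subst_right[OF r\<^sub>1_hom[OF x] m(1) z(1) m(3)] z(2)
          Comp_subst_right[OF r\<^sub>1_hom[OF x] p'_hom[OF x] qf\<^sub>0 p'_r\<^sub>1[OF x]] by simp
    qed (use Comp_in_hom m(1) z(1) qf\<^sub>0 p'_hom[OF x] in blast)+
    then have "q \<cdot> m \<cdot> s x = ((q \<cdot> f\<^sub>0) \<cdot> p' x) \<cdot> s x"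
      using Comp_assoc[OF s m(1) z(1)] by simp
    also have "\<dots> = (q \<cdot> f\<^sub>0) \<cdot> p x"
      using Comp_subst_right[OF s p'_hom[OF x] qf\<^sub>0 p'_s[OF x]] .
    finally show ?thesis using z(1) by blast
  qed
  ultimately show ?thesis
    unfolding homotopic_def using Comp_in_hom[OF s m(1)] x by blast
qed

text \<open>Naturality of \<open>p\<close> keeps the precomposed homotopy stationary.\<close>

lemma homotopic_Comp_right:
  assumes H: "homotopic W x y f\<^sub>0 f\<^sub>1" and e: "e \<in> hom D w x"
  shows "homotopic W w y (f\<^sub>0 \<cdot> e) (f\<^sub>1 \<cdot> e)"
proof -
  from H obtain h where h: "h \<in> hom D (C x) y" "h \<cdot> i\<^sub>0 x = f\<^sub>0" "h \<cdot> i\<^sub>1 x = f\<^sub>1"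
    and W: "\<And>q. q \<in> W \<Longrightarrow> \<exists>z. q \<in> hom D y z \<and> q \<cdot> h = (q \<cdot> f\<^sub>0) \<cdot> p x" and x: "x \<in> Obj D"
    unfolding homotopic_def by blast
  have w: "w \<in> Obj D" using homD(1)[OF e] .
  have Ce: "C' e \<in> hom D (C w) (C x)" using C'_hom[OF e] .
  have "(h \<cdot> C' e) \<cdot> i\<^sub>0 w = f\<^sub>0 \<cdot> e"
    using Comp_subst_right[OF i\<^sub>0_hom[OF w] Ce h(1) i\<^sub>0_nat[OF e]]
      Comp_assoc[OF e i\<^sub>0_hom[OF x] h(1)] h(2) by simp
  moreover have "(h \<cdot> C' e) \<cdot> i\<^sub>1 w = f\<^sub>1 \<cdot> e"
    using Comp_subst_right[OF i\<^sub>1_hom[OF w] Ce h(1) i\<^sub>1_nat[OF e]]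
      Comp_assoc[OF e i\<^sub>1_hom[OF x] h(1)] h(3) by simp
  moreover have "\<exists>z. q \<in> hom D y z \<and> q \<cdot> h \<cdot> C' e = (q \<cdot> f\<^sub>0 \<cdot> e) \<cdot> p w" if q: "q \<in> W" for q
  proof -
    from W[OF q] obtain z where z: "q \<in> hom D y z" "q \<cdot> h = (q \<cdot> f\<^sub>0) \<cdot> p x" by blast
    have f\<^sub>0: "f\<^sub>0 \<in> hom D x y" using homotopic_hom(1)[OF H] .
    have qf\<^sub>0: "q \<cdot> f\<^sub>0 \<in> hom D x z" using Comp_in_hom[OF f\<^sub>0 z(1)] .
    have "q \<cdot> h \<cdot> C' e = ((q \<cdot> f\<^sub>0) \<cdot> p x) \<cdot> C' e"
      using Comp_assoc[OF Ce h(1) z(1)] z(2) by simp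
    also have "\<dots> = (q \<cdot> f\<^sub>0) \<cdot> e \<cdot> p w"
      using Comp_subst_right[OF Ce p_hom[OF x] qf\<^sub>0 p_nat[OF e]] .
    also have "\<dots> = (q \<cdot> f\<^sub>0 \<cdot> e) \<cdot> p w"
      using Comp_assoc[OF p_hom[OF w] e qf\<^sub>0] Comp_assoc[OF e f\<^sub>0 z(1)] by simp
    finally show ?thesis using z(1) by blast
  qed
  ultimately show ?thesis
    unfolding homotopic_def using Comp_in_hom[OF Ce h(1)] w by blast
qed

lemma homotopic_Comp_left:
  assumes H: "homotopic W x y f\<^sub>0 f\<^sub>1" and g: "g \<in> hom D y y'"
    and W': "\<And>q. q \<in> W' \<Longrightarrow> \<exists>z. q \<in> hom D y' z \<and> q \<cdot> g \<in> W"
  shows "homotopic W' x y' (g \<cdot> f\<^sub>0) (g \<cdot> f\<^sub>1)"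
proof -
  from H obtain h where h: "h \<in> hom D (C x) y" "h \<cdot> i\<^sub>0 x = f\<^sub>0" "h \<cdot> i\<^sub>1 x = f\<^sub>1"
    and W: "\<And>q. q \<in> W \<Longrightarrow> q \<cdot> h = (q \<cdot> f\<^sub>0) \<cdot> p x" and x: "x \<in> Obj D"
    unfolding homotopic_def by blast
  have f\<^sub>0: "f\<^sub>0 \<in> hom D x y" using homotopic_hom(1)[OF H] .
  have "(g \<cdot> h) \<cdot> i\<^sub>0 x = g \<cdot> f\<^sub>0" "(g \<cdot> h) \<cdot> i\<^sub>1 x = g \<cdot> f\<^sub>1"
    using Comp_subst_right[OF i\<^sub>0_hom[OF x] h(1) g h(2)]
      Comp_subst_right[OF i\<^sub>1_hom[OF x] h(1) g h(3)] by auto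
  moreover have "\<exists>z. q \<in> hom D y' z \<and> q \<cdot> g \<cdot> h = (q \<cdot> g \<cdot> f\<^sub>0) \<cdot> p x" if q: "q \<in> W'" for q
  proof -
    from W'[OF q] obtain z where z: "q \<in> hom D y' z" "q \<cdot> g \<in> W" by blast
    show ?thesis
      using z(1) Comp_assoc[OF h(1) g z(1)] Comp_assoc[OF f\<^sub>0 g z(1)] W[OF z(2)] by auto
  qed
  ultimately show ?thesis
    unfolding homotopic_def using Comp_in_hom[OF h(1) g] x by blast
qed

section \<open>Lifting null homotopies\<close>

definition fibration :: "'o \<Rightarrow> 'o \<Rightarrow> 'a \<Rightarrow> bool" where
  "fibration y z j \<longleftrightarrow> j \<in> hom D y z \<and>
    (\<forall>x \<in> Obj D. \<forall>g \<in> hom D x y. \<forall>h \<in> hom D (C x) z. h \<cdot> i\<^sub>0 x = j \<cdot> g \<longrightarrow>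
      (\<exists>l \<in> hom D (C x) y. l \<cdot> i\<^sub>0 x = g \<and> j \<cdot> l = h))"

text \<open>
  The loop \<open>n s\<close> traverses \<open>k\<close> backwards and then forwards, from \<open>k i\<^sub>1\<close> to \<open>k i\<^sub>1\<close>. Contract its
  second half by \<open>k \<Gamma>\<close>, which starts at \<open>k\<close> and is constant on the faces \<open>i\<^sub>1\<close> and \<open>C'(i\<^sub>1)\<close>, and its
  first half by the mirror image \<open>k \<Gamma> C'(v)\<close>. Both restrict to \<open>k\<close> on the face where the
  halves meet, so they glue; the four faces of the result are then read off half by half.
\<close>

lemma null_homotopy:
  assumes b: "b \<in> Obj D" and k: "k \<in> hom D (C b) a"
    and n: "n \<in> hom D (S b) a" "n \<cdot> r\<^sub>0 b = k" "n \<cdot> r\<^sub>1 b = k \<cdot> v b"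
  obtains N where "N \<in> hom D (C (C b)) a"
    and "N \<cdot> i\<^sub>0 (C b) = n \<cdot> s b"
    and "N \<cdot> i\<^sub>1 (C b) = (k \<cdot> i\<^sub>1 b) \<cdot> p b"
    and "N \<cdot> C' (i\<^sub>0 b) = (k \<cdot> i\<^sub>1 b) \<cdot> p b"
    and "N \<cdot> C' (i\<^sub>1 b) = (k \<cdot> i\<^sub>1 b) \<cdot> p b"
proof -
  note Cb = C_Obj[OF b] and Sb = S_Obj[OF b]
  note Cty = C'_hom[OF i\<^sub>0_hom[OF b]] C'_hom[OF i\<^sub>1_hom[OF b]] C'_hom[OF v_hom[OF b]]
    C'_hom[OF r\<^sub>0_hom[OF b]] C'_hom[OF r\<^sub>1_hom[OF b]] C'_hom[OF s_hom[OF b]]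
  let ?c = "k \<cdot> i\<^sub>1 b"
  have c: "?c \<in> hom D b a" using Comp_in_hom[OF i\<^sub>1_hom[OF b] k] .
  have c_p: "k \<cdot> i\<^sub>1 b \<cdot> p b = ?c \<cdot> p b" using Comp_assoc[OF p_hom[OF b] i\<^sub>1_hom[OF b] k] .
  define N\<^sub>0 where "N\<^sub>0 = k \<cdot> \<Gamma> b"
  define N\<^sub>1 where "N\<^sub>1 = N\<^sub>0 \<cdot> C' (v b)"
  have N\<^sub>0: "N\<^sub>0 \<in> hom D (C (C b)) a" unfolding N\<^sub>0_def using Comp_in_hom[OF \<Gamma>_hom[OF b] k] .
  have N\<^sub>1: "N\<^sub>1 \<in> hom D (C (C b)) a" unfolding N\<^sub>1_def using Comp_in_hom[OF Cty(3) N\<^sub>0] .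
  have N\<^sub>0_i: "N\<^sub>0 \<cdot> i\<^sub>0 (C b) = k" "N\<^sub>0 \<cdot> C' (i\<^sub>0 b) = k"
    "N\<^sub>0 \<cdot> i\<^sub>1 (C b) = ?c \<cdot> p b" "N\<^sub>0 \<cdot> C' (i\<^sub>1 b) = ?c \<cdot> p b"
    unfolding N\<^sub>0_def
    using Comp_subst_right[OF i\<^sub>0_hom[OF Cb] \<Gamma>_hom[OF b] k \<Gamma>_i\<^sub>0[OF b]]
      Comp_subst_right[OF Cty(1) \<Gamma>_hom[OF b] k \<Gamma>_C'_i\<^sub>0[OF b]]
      Comp_subst_right[OF i\<^sub>1_hom[OF Cb] \<Gamma>_hom[OF b] k \<Gamma>_i\<^sub>1[OF b]]
      Comp_subst_right[OF Cty(2) \<Gamma>_hom[OF b] k \<Gamma>_C'_i\<^sub>1[OF b]] Comp_Id[OF k] c_p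
    by auto
  have Cv_i: "C' (v b) \<cdot> C' (i\<^sub>0 b) = C' (i\<^sub>1 b)" "C' (v b) \<cdot> C' (i\<^sub>1 b) = C' (i\<^sub>0 b)"
    using C'_Comp[OF i\<^sub>0_hom[OF b] v_hom[OF b]] C'_Comp[OF i\<^sub>1_hom[OF b] v_hom[OF b]]
      v_i\<^sub>0[OF b] v_i\<^sub>1[OF b] by auto
  have N\<^sub>1_i: "N\<^sub>1 \<cdot> i\<^sub>0 (C b) = k \<cdot> v b" "N\<^sub>1 \<cdot> C' (i\<^sub>0 b) = ?c \<cdot> p b"
    "N\<^sub>1 \<cdot> i\<^sub>1 (C b) = ?c \<cdot> p b" "N\<^sub>1 \<cdot> C' (i\<^sub>1 b) = k"
  proof -
    show "N\<^sub>1 \<cdot> i\<^sub>0 (C b) = k \<cdot> v b"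
      unfolding N\<^sub>1_def
      using Comp_subst_right[OF i\<^sub>0_hom[OF Cb] Cty(3) N\<^sub>0 i\<^sub>0_nat[OF v_hom[OF b]]]
        Comp_assoc[OF v_hom[OF b] i\<^sub>0_hom[OF Cb] N\<^sub>0] N\<^sub>0_i(1) by simp
    show "N\<^sub>1 \<cdot> i\<^sub>1 (C b) = ?c \<cdot> p b"
      unfolding N\<^sub>1_def
      using Comp_subst_right[OF i\<^sub>1_hom[OF Cb] Cty(3) N\<^sub>0 i\<^sub>1_nat[OF v_hom[OF b]]]
        Comp_assoc[OF v_hom[OF b] i\<^sub>1_hom[OF Cb] N\<^sub>0] N\<^sub>0_i(3)
        Comp_subst_right[OF v_hom[OF b] p_hom[OF b] c p_v[OF b]] by simp
    show "N\<^sub>1 \<cdot> C' (i\<^sub>0 b) = ?c \<cdot> p b" "N\<^sub>1 \<cdot> C' (i\<^sub>1 b) = k"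
      unfolding N\<^sub>1_def
      using Comp_subst_right[OF Cty(1) Cty(3) N\<^sub>0 Cv_i(1)]
        Comp_subst_right[OF Cty(2) Cty(3) N\<^sub>0 Cv_i(2)] N\<^sub>0_i by auto
  qed
  obtain M where M: "M \<in> hom D (C (S b)) a" "M \<cdot> C' (r\<^sub>0 b) = N\<^sub>0" "M \<cdot> C' (r\<^sub>1 b) = N\<^sub>1"
    using C'_S_glue[OF b N\<^sub>0 N\<^sub>1] N\<^sub>0_i(2) N\<^sub>1_i(4) by auto
  \<comment> \<open>The faces of \<open>M\<close> in the contracting direction, restricted to either half of the loop.\<close>
  have face: "(M \<cdot> \<iota> (S b)) \<cdot> r b = (M \<cdot> C' (r b)) \<cdot> \<iota> (C b)"
    if "r b \<in> hom D (C b) (S b)" "\<iota> (S b) \<in> hom D (S b) (C (S b))"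
      "\<iota> (C b) \<in> hom D (C b) (C (C b))" "C' (r b) \<cdot> \<iota> (C b) = \<iota> (S b) \<cdot> r b" for r \<iota>
    using Comp_assoc[OF that(1,2) M(1)] Comp_assoc[OF that(3) C'_hom[OF that(1)] M(1)] that(4)
    by simp
  have M_i\<^sub>0: "M \<cdot> i\<^sub>0 (S b) = n"
  proof (rule S_ext[OF b _ n(1)])
    show "M \<cdot> i\<^sub>0 (S b) \<in> hom D (S b) a" using Comp_in_hom[OF i\<^sub>0_hom[OF Sb] M(1)] .
    show "(M \<cdot> i\<^sub>0 (S b)) \<cdot> r\<^sub>0 b = n \<cdot> r\<^sub>0 b"
      using face[of r\<^sub>0 i\<^sub>0, OF r\<^sub>0_hom[OF b] i\<^sub>0_hom[OF Sb] i\<^sub>0_hom[OF Cb] i\<^sub>0_nat[OF r\<^sub>0_hom[OF b]]]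
        M(2) N\<^sub>0_i(1) n(2) by simp
    show "(M \<cdot> i\<^sub>0 (S b)) \<cdot> r\<^sub>1 b = n \<cdot> r\<^sub>1 b"
      using face[of r\<^sub>1 i\<^sub>0, OF r\<^sub>1_hom[OF b] i\<^sub>0_hom[OF Sb] i\<^sub>0_hom[OF Cb] i\<^sub>0_nat[OF r\<^sub>1_hom[OF b]]]
        M(3) N\<^sub>1_i(1) n(3) by simp
  qed
  have M_i\<^sub>1: "M \<cdot> i\<^sub>1 (S b) = ?c \<cdot> p' b"
  proof (rule S_ext[OF b])
    show "M \<cdot> i\<^sub>1 (S b) \<in> hom D (S b) a" using Comp_in_hom[OF i\<^sub>1_hom[OF Sb] M(1)] .
    show "?c \<cdot> p' b \<in> hom D (S b) a" using Comp_in_hom[OF p'_hom[OF b] c] .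
    show "(M \<cdot> i\<^sub>1 (S b)) \<cdot> r\<^sub>0 b = (?c \<cdot> p' b) \<cdot> r\<^sub>0 b"
      using face[of r\<^sub>0 i\<^sub>1, OF r\<^sub>0_hom[OF b] i\<^sub>1_hom[OF Sb] i\<^sub>1_hom[OF Cb] i\<^sub>1_nat[OF r\<^sub>0_hom[OF b]]]
        M(2) N\<^sub>0_i(3) Comp_subst_right[OF r\<^sub>0_hom[OF b] p'_hom[OF b] c p'_r\<^sub>0[OF b]] by simp
    show "(M \<cdot> i\<^sub>1 (S b)) \<cdot> r\<^sub>1 b = (?c \<cdot> p' b) \<cdot> r\<^sub>1 b"
      using face[of r\<^sub>1 i\<^sub>1, OF r\<^sub>1_hom[OF b] i\<^sub>1_hom[OF Sb] i\<^sub>1_hom[OF Cb] i\<^sub>1_nat[OF r\<^sub>1_hom[OF b]]]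
        M(3) N\<^sub>1_i(3) Comp_subst_right[OF r\<^sub>1_hom[OF b] p'_hom[OF b] c p'_r\<^sub>1[OF b]] by simp
  qed
  show ?thesis
  proof (rule that[of "M \<cdot> C' (s b)"])
    show "M \<cdot> C' (s b) \<in> hom D (C (C b)) a" using Comp_in_hom[OF Cty(6) M(1)] .
    show "(M \<cdot> C' (s b)) \<cdot> i\<^sub>0 (C b) = n \<cdot> s b"
      using Comp_subst_right[OF i\<^sub>0_hom[OF Cb] Cty(6) M(1) i\<^sub>0_nat[OF s_hom[OF b]]]
        Comp_assoc[OF s_hom[OF b] i\<^sub>0_hom[OF Sb] M(1)] M_i\<^sub>0 by simp
    show "(M \<cdot> C' (s b)) \<cdot> i\<^sub>1 (C b) = ?c \<cdot> p b"
      using Comp_subst_right[OF i\<^sub>1_hom[OF Cb] Cty(6) M(1) i\<^sub>1_nat[OF s_hom[OF b]]]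
        Comp_assoc[OF s_hom[OF b] i\<^sub>1_hom[OF Sb] M(1)] M_i\<^sub>1
        Comp_subst_right[OF s_hom[OF b] p'_hom[OF b] c p'_s[OF b]] by simp
    have "C' (s b) \<cdot> C' (i\<^sub>0 b) = C' (r\<^sub>1 b) \<cdot> C' (i\<^sub>0 b)"
      using C'_Comp[OF i\<^sub>0_hom[OF b] s_hom[OF b]] C'_Comp[OF i\<^sub>0_hom[OF b] r\<^sub>1_hom[OF b]] s_i\<^sub>0[OF b]
      by simp
    from Comp_subst_right[OF Cty(1) Cty(6) M(1) this]
    show "(M \<cdot> C' (s b)) \<cdot> C' (i\<^sub>0 b) = ?c \<cdot> p b"
      using Comp_assoc[OF Cty(1) Cty(5) M(1)] M(3) N\<^sub>1_i(2) by simp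
    have "C' (s b) \<cdot> C' (i\<^sub>1 b) = C' (r\<^sub>0 b) \<cdot> C' (i\<^sub>1 b)"
      using C'_Comp[OF i\<^sub>1_hom[OF b] s_hom[OF b]] C'_Comp[OF i\<^sub>1_hom[OF b] r\<^sub>0_hom[OF b]] s_i\<^sub>1[OF b]
      by simp
    from Comp_subst_right[OF Cty(2) Cty(6) M(1) this]
    show "(M \<cdot> C' (s b)) \<cdot> C' (i\<^sub>1 b) = ?c \<cdot> p b"
      using Comp_assoc[OF Cty(2) Cty(4) M(1)] M(2) N\<^sub>0_i(4) by simp
  qed
qed

text \<open>
  The image of the path \<open>m s\<close> in \<open>a\<close> runs backwards and then forwards along the same homotopy. Lift
  the null homotopy of this image, starting at \<open>m s\<close>; the three remaining faces of the lift have
  constant image and form a route around the square from one end of \<open>m s\<close> to the other.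
\<close>

lemma ends_homotopic_over:
  assumes b: "b \<in> Obj D" and j: "fibration y a j"
    and m: "m \<in> hom D (S b) y" "j \<cdot> m \<cdot> r\<^sub>1 b = (j \<cdot> m \<cdot> r\<^sub>0 b) \<cdot> v b"
  shows "homotopic {j} b y (m \<cdot> r\<^sub>1 b \<cdot> i\<^sub>0 b) (m \<cdot> r\<^sub>0 b \<cdot> i\<^sub>1 b)"
proof -
  note Cb = C_Obj[OF b]
  note i\<^sub>0b = i\<^sub>0_hom[OF b] and i\<^sub>1b = i\<^sub>1_hom[OF b] and i\<^sub>0Cb = i\<^sub>0_hom[OF Cb] and i\<^sub>1Cb = i\<^sub>1_hom[OF Cb]
    and pb = p_hom[OF b]
  note Ci\<^sub>0 = C'_hom[OF i\<^sub>0b] and Ci\<^sub>1 = C'_hom[OF i\<^sub>1b]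
  have jh: "j \<in> hom D y a" using j by (simp add: fibration_def)
  define k where "k = j \<cdot> m \<cdot> r\<^sub>0 b"
  have k: "k \<in> hom D (C b) a"
    unfolding k_def using Comp_in_hom[OF Comp_in_hom[OF r\<^sub>0_hom[OF b] m(1)] jh] .
  have jm: "j \<cdot> m \<in> hom D (S b) a" using Comp_in_hom[OF m(1) jh] .
  let ?c = "k \<cdot> i\<^sub>1 b"
  have c: "?c \<in> hom D b a" using Comp_in_hom[OF i\<^sub>1b k] .
  have "(j \<cdot> m) \<cdot> r\<^sub>0 b = k" "(j \<cdot> m) \<cdot> r\<^sub>1 b = k \<cdot> v b"
    using Comp_assoc[OF r\<^sub>0_hom[OF b] m(1) jh] Comp_assoc[OF r\<^sub>1_hom[OF b] m(1) jh] m(2) k_def by auto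
  then obtain N where N: "N \<in> hom D (C (C b)) a" "N \<cdot> i\<^sub>0 (C b) = (j \<cdot> m) \<cdot> s b"
    "N \<cdot> i\<^sub>1 (C b) = ?c \<cdot> p b" "N \<cdot> C' (i\<^sub>0 b) = ?c \<cdot> p b" "N \<cdot> C' (i\<^sub>1 b) = ?c \<cdot> p b"
    using null_homotopy[OF b k jm] by blast
  have ms: "m \<cdot> s b \<in> hom D (C b) y" using Comp_in_hom[OF s_hom[OF b] m(1)] .
  have "N \<cdot> i\<^sub>0 (C b) = j \<cdot> m \<cdot> s b" using N(2) Comp_assoc[OF s_hom[OF b] m(1) jh] by simp
  then obtain L where L: "L \<in> hom D (C (C b)) y" "L \<cdot> i\<^sub>0 (C b) = m \<cdot> s b" "j \<cdot> L = N"
    using j Cb ms N(1) unfolding fibration_def by blast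
  \<comment> \<open>Every face of \<open>L\<close> on which \<open>N\<close> is constant is a homotopy over \<open>a\<close>.\<close>
  have edge: "homotopic {j} b y ((L \<cdot> e) \<cdot> i\<^sub>0 b) ((L \<cdot> e) \<cdot> i\<^sub>1 b)"
    if e: "e \<in> hom D (C b) (C (C b))" "N \<cdot> e = ?c \<cdot> p b" for e
  proof -
    have Le: "L \<cdot> e \<in> hom D (C b) y" using Comp_in_hom[OF e(1) L(1)] .
    have jLe: "j \<cdot> L \<cdot> e = ?c \<cdot> p b" using Comp_assoc[OF e(1) L(1) jh] L(3) e(2) by simp
    have "j \<cdot> (L \<cdot> e) \<cdot> i\<^sub>0 b = ?c"
      using Comp_assoc[OF i\<^sub>0b Le jh] jLe Comp_subst_right[OF i\<^sub>0b pb c p_i\<^sub>0[OF b]] Comp_Id[OF c]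
      by simp
    then show ?thesis unfolding homotopic_def using Le jLe jh b by auto
  qed
  have "(L \<cdot> C' (i\<^sub>0 b)) \<cdot> i\<^sub>0 b = m \<cdot> r\<^sub>1 b \<cdot> i\<^sub>0 b"
    using Comp_subst_right[OF i\<^sub>0b Ci\<^sub>0 L(1) i\<^sub>0_nat[OF i\<^sub>0b]] Comp_assoc[OF i\<^sub>0b i\<^sub>0Cb L(1)] L(2)
      Comp_subst_right[OF i\<^sub>0b s_hom[OF b] m(1) s_i\<^sub>0[OF b]] by simp
  moreover have "(L \<cdot> C' (i\<^sub>0 b)) \<cdot> i\<^sub>1 b = (L \<cdot> i\<^sub>1 (C b)) \<cdot> i\<^sub>0 b"
    using Comp_subst_right[OF i\<^sub>1b Ci\<^sub>0 L(1) i\<^sub>1_nat[OF i\<^sub>0b]] Comp_assoc[OF i\<^sub>0b i\<^sub>1Cb L(1)] by simp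
  moreover have "(L \<cdot> C' (i\<^sub>1 b)) \<cdot> i\<^sub>0 b = m \<cdot> r\<^sub>0 b \<cdot> i\<^sub>1 b"
    using Comp_subst_right[OF i\<^sub>0b Ci\<^sub>1 L(1) i\<^sub>0_nat[OF i\<^sub>1b]] Comp_assoc[OF i\<^sub>1b i\<^sub>0Cb L(1)] L(2)
      Comp_subst_right[OF i\<^sub>1b s_hom[OF b] m(1) s_i\<^sub>1[OF b]] by simp
  moreover have "(L \<cdot> C' (i\<^sub>1 b)) \<cdot> i\<^sub>1 b = (L \<cdot> i\<^sub>1 (C b)) \<cdot> i\<^sub>1 b"
    using Comp_subst_right[OF i\<^sub>1b Ci\<^sub>1 L(1) i\<^sub>1_nat[OF i\<^sub>1b]] Comp_assoc[OF i\<^sub>1b i\<^sub>1Cb L(1)] by simp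
  ultimately show ?thesis
    using edge[OF Ci\<^sub>0 N(4)] edge[OF i\<^sub>1Cb N(3)] edge[OF Ci\<^sub>1 N(5)]
      homotopic_trans homotopic_sym by metis
qed

section \<open>Inverses over the base\<close>

text \<open>Lift \<open>j\<^sub>1 h\<close>, where \<open>h\<close> is the given homotopy from \<open>f g\<close> to the identity, along \<open>j\<^sub>0\<close>
  to a homotopy \<open>l\<close> from \<open>g\<close> to an arrow \<open>F\<close> over \<open>a\<close>. The reverse of \<open>f l\<close> and \<open>h\<close> then have
  mutually reverse images in \<open>a\<close>.\<close>

lemma right_inverse_over:
  assumes j\<^sub>0: "fibration a\<^sub>0 a j\<^sub>0" and j\<^sub>1: "fibration a\<^sub>1 a j\<^sub>1"
    and f: "f \<in> hom D a\<^sub>0 a\<^sub>1" "j\<^sub>1 \<cdot> f = j\<^sub>0"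
    and g: "g \<in> hom D a\<^sub>1 a\<^sub>0" and fg: "homotopic {} a\<^sub>1 a\<^sub>1 (f \<cdot> g) (Id D a\<^sub>1)"
  obtains F where "F \<in> hom D a\<^sub>1 a\<^sub>0" "j\<^sub>0 \<cdot> F = j\<^sub>1" "homotopic {j\<^sub>1} a\<^sub>1 a\<^sub>1 (f \<cdot> F) (Id D a\<^sub>1)"
proof -
  have j\<^sub>0h: "j\<^sub>0 \<in> hom D a\<^sub>0 a" and j\<^sub>1h: "j\<^sub>1 \<in> hom D a\<^sub>1 a"
    using j\<^sub>0 j\<^sub>1 by (auto simp: fibration_def)
  have b: "a\<^sub>1 \<in> Obj D" using homD(1)[OF g] .
  note i\<^sub>0b = i\<^sub>0_hom[OF b] and i\<^sub>1b = i\<^sub>1_hom[OF b] and vb = v_hom[OF b]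
  from fg obtain h where h: "h \<in> hom D (C a\<^sub>1) a\<^sub>1" "h \<cdot> i\<^sub>0 a\<^sub>1 = f \<cdot> g" "h \<cdot> i\<^sub>1 a\<^sub>1 = Id D a\<^sub>1"
    unfolding homotopic_def by blast
  define k where "k = j\<^sub>1 \<cdot> h"
  have k: "k \<in> hom D (C a\<^sub>1) a" unfolding k_def using Comp_in_hom[OF h(1) j\<^sub>1h] .
  have "k \<cdot> i\<^sub>0 a\<^sub>1 = j\<^sub>0 \<cdot> g"
    unfolding k_def using Comp_subst_right[OF i\<^sub>0b h(1) j\<^sub>1h h(2)] Comp_assoc[OF g f(1) j\<^sub>1h] f(2) by simp
  then obtain l where l: "l \<in> hom D (C a\<^sub>1) a\<^sub>0" "l \<cdot> i\<^sub>0 a\<^sub>1 = g" "j\<^sub>0 \<cdot> l = k"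
    using j\<^sub>0 b g k unfolding fibration_def by blast
  define F where "F = l \<cdot> i\<^sub>1 a\<^sub>1"
  have F: "F \<in> hom D a\<^sub>1 a\<^sub>0" unfolding F_def using Comp_in_hom[OF i\<^sub>1b l(1)] .
  have j\<^sub>0F: "j\<^sub>0 \<cdot> F = j\<^sub>1"
    unfolding F_def using Comp_assoc[OF i\<^sub>1b l(1) j\<^sub>0h] l(3) k_def
      Comp_subst_right[OF i\<^sub>1b h(1) j\<^sub>1h h(3)] Comp_Id[OF j\<^sub>1h] by simp
  have fl: "f \<cdot> l \<in> hom D (C a\<^sub>1) a\<^sub>1" using Comp_in_hom[OF l(1) f(1)] .
  have flv: "(f \<cdot> l) \<cdot> v a\<^sub>1 \<in> hom D (C a\<^sub>1) a\<^sub>1" using Comp_in_hom[OF vb fl] .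
  have "h \<cdot> i\<^sub>0 a\<^sub>1 = ((f \<cdot> l) \<cdot> v a\<^sub>1) \<cdot> i\<^sub>1 a\<^sub>1"
    using h(2) Comp_subst_right[OF i\<^sub>1b vb fl v_i\<^sub>1[OF b]] Comp_subst_right[OF i\<^sub>0b l(1) f(1) l(2)] by simp
  then obtain m where m: "m \<in> hom D (S a\<^sub>1) a\<^sub>1" "m \<cdot> r\<^sub>0 a\<^sub>1 = h" "m \<cdot> r\<^sub>1 a\<^sub>1 = (f \<cdot> l) \<cdot> v a\<^sub>1"
    using S_glue[OF b h(1) flv] by blast
  have "j\<^sub>1 \<cdot> m \<cdot> r\<^sub>1 a\<^sub>1 = (j\<^sub>1 \<cdot> m \<cdot> r\<^sub>0 a\<^sub>1) \<cdot> v a\<^sub>1"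
    unfolding m(2,3) k_def[symmetric]
    using Comp_assoc[OF vb fl j\<^sub>1h] Comp_assoc[OF l(1) f(1) j\<^sub>1h] f(2) l(3) by simp
  from ends_homotopic_over[OF b j\<^sub>1 m(1) this]
  have "homotopic {j\<^sub>1} a\<^sub>1 a\<^sub>1 (((f \<cdot> l) \<cdot> v a\<^sub>1) \<cdot> i\<^sub>0 a\<^sub>1) (Id D a\<^sub>1)"
    using Comp_assoc[OF i\<^sub>0b r\<^sub>1_hom[OF b] m(1)] Comp_assoc[OF i\<^sub>1b r\<^sub>0_hom[OF b] m(1)] m(2,3) h(3) by simp
  moreover have "((f \<cdot> l) \<cdot> v a\<^sub>1) \<cdot> i\<^sub>0 a\<^sub>1 = f \<cdot> F"
    unfolding F_def
    using Comp_subst_right[OF i\<^sub>0b vb fl v_i\<^sub>0[OF b]] Comp_assoc[OF i\<^sub>1b l(1) f(1)] by simp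
  ultimately show ?thesis using that F j\<^sub>0F by simp
qed

text \<open>The chain is \<open>F f \<simeq> g f F f \<simeq> g f \<simeq> 1\<close>.\<close>

lemma left_inverse_of_right_inverse:
  assumes f: "f \<in> hom D x y" and F: "F \<in> hom D y x"
    and fF: "homotopic W y y (f \<cdot> F) (Id D y)"
    and g: "g \<in> hom D y x" and gf: "homotopic V x x (g \<cdot> f) (Id D x)"
    and W: "\<And>q. q \<in> V \<Longrightarrow> \<exists>z. q \<in> hom D x z \<and> q \<cdot> g \<in> W"
  shows "homotopic V x x (F \<cdot> f) (Id D x)"
proof -
  have Ff: "F \<cdot> f \<in> hom D x x" and gfh: "g \<cdot> f \<in> hom D x x"
    using Comp_in_hom[OF f F] Comp_in_hom[OF f g] by auto
  have "homotopic V x x (g \<cdot> (f \<cdot> F) \<cdot> f) (g \<cdot> Id D y \<cdot> f)"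
    by (rule homotopic_Comp_left[OF homotopic_Comp_right[OF fF f] g W])
  moreover have "homotopic V x x ((g \<cdot> f) \<cdot> F \<cdot> f) (Id D x \<cdot> F \<cdot> f)"
    by (rule homotopic_Comp_right[OF gf Ff])
  moreover have "(g \<cdot> f) \<cdot> F \<cdot> f = g \<cdot> (f \<cdot> F) \<cdot> f"
    using Comp_assoc[OF Ff f g] Comp_assoc[OF f F f] by simp
  ultimately have "homotopic V x x (F \<cdot> f) (g \<cdot> f)"
    using homotopic_sym homotopic_trans Id_Comp[OF f] Id_Comp[OF Ff] by metis
  then show ?thesis using gf homotopic_trans by blast
qed

text \<open>The right inverse \<open>F\<close> of \<open>f\<close> has in turn a right inverse \<open>G\<close> over \<open>a\<close>, and
  \<open>F f \<simeq> F f F G \<simeq> F G \<simeq> 1\<close> over \<open>a\<close>.\<close>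

theorem homotopy_inverse_over:
  assumes j\<^sub>0: "fibration a\<^sub>0 a j\<^sub>0" and j\<^sub>1: "fibration a\<^sub>1 a j\<^sub>1"
    and f: "f \<in> hom D a\<^sub>0 a\<^sub>1" "j\<^sub>1 \<cdot> f = j\<^sub>0"
    and g: "g \<in> hom D a\<^sub>1 a\<^sub>0" and gf: "homotopic {} a\<^sub>0 a\<^sub>0 (g \<cdot> f) (Id D a\<^sub>0)"
    and fg: "homotopic {} a\<^sub>1 a\<^sub>1 (f \<cdot> g) (Id D a\<^sub>1)"
  obtains F where "F \<in> hom D a\<^sub>1 a\<^sub>0" "j\<^sub>0 \<cdot> F = j\<^sub>1"
    "homotopic {j\<^sub>0} a\<^sub>0 a\<^sub>0 (F \<cdot> f) (Id D a\<^sub>0)" "homotopic {j\<^sub>1} a\<^sub>1 a\<^sub>1 (f \<cdot> F) (Id D a\<^sub>1)"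
proof -
  have j\<^sub>0h: "j\<^sub>0 \<in> hom D a\<^sub>0 a" and j\<^sub>1h: "j\<^sub>1 \<in> hom D a\<^sub>1 a"
    using j\<^sub>0 j\<^sub>1 by (auto simp: fibration_def)
  obtain F where F: "F \<in> hom D a\<^sub>1 a\<^sub>0" "j\<^sub>0 \<cdot> F = j\<^sub>1" "homotopic {j\<^sub>1} a\<^sub>1 a\<^sub>1 (f \<cdot> F) (Id D a\<^sub>1)"
    using right_inverse_over[OF j\<^sub>0 j\<^sub>1 f g fg] .
  have "homotopic {} a\<^sub>0 a\<^sub>0 (F \<cdot> f) (Id D a\<^sub>0)"
    using left_inverse_of_right_inverse[OF f(1) F(1) F(3) g gf] by simp
  then obtain G where G: "G \<in> hom D a\<^sub>0 a\<^sub>1" "j\<^sub>1 \<cdot> G = j\<^sub>0" "homotopic {j\<^sub>0} a\<^sub>0 a\<^sub>0 (F \<cdot> G) (Id D a\<^sub>0)"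
    using right_inverse_over[OF j\<^sub>1 j\<^sub>0 F(1,2) f(1)] by blast
  have "homotopic {j\<^sub>0} a\<^sub>0 a\<^sub>0 (F \<cdot> f) (Id D a\<^sub>0)"
  proof -
    have Ff: "F \<cdot> f \<in> hom D a\<^sub>0 a\<^sub>0" using Comp_in_hom[OF f(1) F(1)] .
    have "homotopic {j\<^sub>0} a\<^sub>0 a\<^sub>0 (F \<cdot> (f \<cdot> F) \<cdot> G) (F \<cdot> Id D a\<^sub>1 \<cdot> G)"
      using homotopic_Comp_left[OF homotopic_Comp_right[OF F(3) G(1)] F(1), of "{j\<^sub>0}"] j\<^sub>0h F(2) by blast
    moreover have "homotopic {j\<^sub>0} a\<^sub>0 a\<^sub>0 ((F \<cdot> f) \<cdot> F \<cdot> G) ((F \<cdot> f) \<cdot> Id D a\<^sub>0)"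
      by (rule homotopic_Comp_left[OF G(3) Ff])
        (use j\<^sub>0h Comp_assoc[OF f(1) F(1) j\<^sub>0h] F(2) f(2) in auto)
    moreover have "(F \<cdot> f) \<cdot> F \<cdot> G = F \<cdot> (f \<cdot> F) \<cdot> G"
      using Comp_assoc[OF Comp_in_hom[OF G(1) F(1)] f(1) F(1)] Comp_assoc[OF G(1) F(1) f(1)] by simp
    ultimately have "homotopic {j\<^sub>0} a\<^sub>0 a\<^sub>0 (F \<cdot> f) (F \<cdot> G)"
      using homotopic_sym homotopic_trans Id_Comp[OF G(1)] Comp_Id[OF Ff] by metis
    then show ?thesis using G(3) homotopic_trans by blast
  qed
  with F that show ?thesis by blast
qed

end

section \<open>Evaluating the formal cylinder at objects\<close>

lemma Hom_simps:
  "Obj (Hom K X Y) = hom (Cells1 K) X Y" "Id (Hom K X Y) = Id (Cells2 K)"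
  "Comp (Hom K X Y) = Comp (Cells2 K)"
  by (simp_all add: Hom_def)

context strict_2_category
begin

lemma in_Hom_iff:
  "\<alpha> \<in> hom (Hom K X Y) F G \<longleftrightarrow>
    \<alpha> \<in> hom (Cells2 K) F G \<and> F \<in> hom (Cells1 K) X Y \<and> G \<in> hom (Cells1 K) X Y"
  by (auto simp: Hom_def hom_def)

lemma id2_hom: "F \<in> hom (Cells1 K) X Y \<Longrightarrow> id2 F \<in> hom (Cells2 K) F F"
  using category.Id_in_hom[OF category_Cells2] Obj_Cells2 by (auto simp: hom_def)

lemma id2_Comp_id2: "F \<in> hom (Cells1 K) X Y \<Longrightarrow> id2 F \<bullet> id2 F = id2 F"
  using category.Comp_Id[OF category_Cells2 id2_hom] .

lemma Comp1_hom:
  "F \<in> hom (Cells1 K) X Y \<Longrightarrow> G \<in> hom (Cells1 K) Y Z \<Longrightarrow> G \<odot> F \<in> hom (Cells1 K) X Z"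
  using category.Comp_in_hom[OF category_Cells1] .

lemma whisker_left_hom:
  assumes "F \<in> hom (Cells1 K) Y Z" "\<alpha> \<in> hom (Hom K X Y) x y"
  shows "F \<triangleright> \<alpha> \<in> hom (Hom K X Z) (F \<odot> x) (F \<odot> y)"
  using assms HComp_in_hom[OF _ assms(1) _ id2_hom[OF assms(1)]] Comp1_hom
  unfolding in_Hom_iff whisker_left_def by blast

lemma whisker_right_hom:
  assumes "x \<in> hom (Cells1 K) X Y" "\<eta> \<in> hom (Hom K Y Z) F G"
  shows "\<eta> \<triangleleft> x \<in> hom (Hom K X Z) (F \<odot> x) (G \<odot> x)"
  using assms HComp_in_hom[OF assms(1) _ id2_hom[OF assms(1)]] Comp1_hom
  unfolding in_Hom_iff whisker_right_def by blast

lemma whisker_left_Comp2: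
  assumes "F \<in> hom (Cells1 K) Y Z" "\<alpha> \<in> hom (Hom K X Y) x y" "\<beta> \<in> hom (Hom K X Y) y z"
  shows "F \<triangleright> (\<beta> \<bullet> \<alpha>) = F \<triangleright> \<beta> \<bullet> F \<triangleright> \<alpha>"
  using assms interchange[OF _ assms(1) _ _ id2_hom[OF assms(1)] id2_hom[OF assms(1)]]
    id2_Comp_id2[OF assms(1)]
  unfolding in_Hom_iff whisker_left_def by metis

lemma whisker_right_Comp2:
  assumes "x \<in> hom (Cells1 K) X Y" "\<eta> \<in> hom (Hom K Y Z) F G" "\<theta> \<in> hom (Hom K Y Z) G H"
  shows "(\<theta> \<bullet> \<eta>) \<triangleleft> x = (\<theta> \<triangleleft> x) \<bullet> (\<eta> \<triangleleft> x)"
  using assms interchange[OF assms(1) _ id2_hom[OF assms(1)] id2_hom[OF assms(1)]]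
    id2_Comp_id2[OF assms(1)]
  unfolding in_Hom_iff whisker_right_def by metis

text \<open>Both sides are the horizontal composite of \<open>\<eta>\<close> and \<open>\<alpha>\<close>.\<close>

lemma whisker_naturality:
  assumes "\<eta> \<in> hom (Hom K Y Z) F G" "\<alpha> \<in> hom (Hom K X Y) x y"
  shows "G \<triangleright> \<alpha> \<bullet> (\<eta> \<triangleleft> x) = (\<eta> \<triangleleft> y) \<bullet> F \<triangleright> \<alpha>"
proof -
  have e: "\<eta> \<in> hom (Cells2 K) F G" "F \<in> hom (Cells1 K) Y Z" "G \<in> hom (Cells1 K) Y Z"
    and a: "\<alpha> \<in> hom (Cells2 K) x y" "x \<in> hom (Cells1 K) X Y" "y \<in> hom (Cells1 K) X Y"
    using assms by (auto simp: in_Hom_iff)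
  interpret V: category "Cells2 K" by (rule category_Cells2)
  have "HComp K (id2 G \<bullet> \<eta>) (\<alpha> \<bullet> id2 x) = HComp K (id2 G) \<alpha> \<bullet> HComp K \<eta> (id2 x)"
    by (rule interchange[OF a(2) e(2) id2_hom[OF a(2)] a(1) e(1) id2_hom[OF e(3)]])
  moreover have "HComp K (\<eta> \<bullet> id2 F) (id2 y \<bullet> \<alpha>) = HComp K \<eta> (id2 y) \<bullet> HComp K (id2 F) \<alpha>"
    by (rule interchange[OF a(2) e(2) a(1) id2_hom[OF a(3)] id2_hom[OF e(2)] e(1)])
  ultimately show ?thesis
    unfolding whisker_left_def whisker_right_def
    using V.Comp_Id[OF e(1)] V.Id_Comp[OF e(1)] V.Comp_Id[OF a(1)] V.Id_Comp[OF a(1)] by simp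
qed

lemma whisker_right_whisker_left:
  assumes "x \<in> hom (Cells1 K) W X" "\<eta> \<in> hom (Hom K X Y) F G" "H \<in> hom (Cells1 K) Y Z"
  shows "(H \<triangleright> \<eta>) \<triangleleft> x = H \<triangleright> (\<eta> \<triangleleft> x)"
  using assms HComp_assoc[OF assms(1) _ assms(3) id2_hom[OF assms(1)] _ id2_hom[OF assms(3)]]
  unfolding in_Hom_iff whisker_right_def whisker_left_def by metis

lemma whisker_right_Comp1:
  assumes "x \<in> hom (Cells1 K) W X" "F \<in> hom (Cells1 K) X Y" "\<eta> \<in> hom (Hom K Y Z) G H"
  shows "(\<eta> \<triangleleft> F) \<triangleleft> x = \<eta> \<triangleleft> (F \<odot> x)"
  using assms HComp_assoc[OF assms(1,2) _ id2_hom[OF assms(1)] id2_hom[OF assms(2)]]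
    HComp_id2[OF assms(1,2)]
  unfolding in_Hom_iff whisker_right_def by metis

lemma id2_whisker_right:
  "x \<in> hom (Cells1 K) X Y \<Longrightarrow> F \<in> hom (Cells1 K) Y Z \<Longrightarrow> id2 F \<triangleleft> x = id2 (F \<odot> x)"
  unfolding whisker_right_def using HComp_id2 .

lemma id1_whisker_left: "\<alpha> \<in> hom (Hom K X Y) x y \<Longrightarrow> id1 Y \<triangleright> \<alpha> = \<alpha>"
  unfolding whisker_left_def in_Hom_iff using HComp_unit_left by blast

lemma id1_Comp1: "x \<in> hom (Cells1 K) X Y \<Longrightarrow> id1 Y \<odot> x = x"
  using category.Id_Comp[OF category_Cells1] .

lemma Comp1_assoc:
  "F \<in> hom (Cells1 K) W X \<Longrightarrow> G \<in> hom (Cells1 K) X Y \<Longrightarrow> H \<in> hom (Cells1 K) Y Z \<Longrightarrow>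
    (H \<odot> G) \<odot> F = H \<odot> G \<odot> F"
  using category.Comp_assoc[OF category_Cells1] by metis

end

lemma (in formal_category) p_bar_props:
  assumes p: "is_contraction K A Cyl i\<^sub>0 i\<^sub>1 p"
    and S: "is_subdivision K A Cyl i\<^sub>0 i\<^sub>1 S r\<^sub>0 r\<^sub>1 s"
  defines "q \<equiv> p_bar K A p S r\<^sub>0 r\<^sub>1"
  shows "q \<in> hom (Hom K A A) S (id1 A)" "q \<bullet> r\<^sub>0 = p" "q \<bullet> r\<^sub>1 = p"
proof -
  have "\<exists>!k. k \<in> hom (Hom K A A) S (id1 A) \<and>
      Comp (Hom K A A) k r\<^sub>0 = p \<and> Comp (Hom K A A) k r\<^sub>1 = p"
    by (rule is_pushoutD[of _ i\<^sub>0 i\<^sub>1])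
      (use p S in \<open>auto simp: is_contraction_def is_subdivision_def Hom_simps in_Hom_iff\<close>)
  then have "\<exists>!k. k \<in> hom (Hom K A A) S (id1 A) \<and> k \<bullet> r\<^sub>0 = p \<and> k \<bullet> r\<^sub>1 = p"
    by (simp add: Hom_simps)
  from theI'[OF this] show "q \<in> hom (Hom K A A) S (id1 A)" "q \<bullet> r\<^sub>0 = p" "q \<bullet> r\<^sub>1 = p"
    unfolding q_def p_bar_def by auto
qed

text \<open>Naturality is the interchange law, and the other equations evaluate the corresponding
  equations between 2-arrows. The two pushouts hold
  because evaluation preserves pushout squares, and the faces of \<open>\<Gamma>\<close> because
  \<open>(i \<triangleleft> Cyl) \<triangleleft> x = i \<triangleleft> (Cyl \<odot> x)\<close> and \<open>(Cyl \<triangleright> i) \<triangleleft> x = Cyl \<triangleright> (i \<triangleleft> x)\<close>.\<close>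

lemma (in formal_category) cylinder_category_evaluation:
  assumes cyl: "is_cylinder K A Cyl i\<^sub>0 i\<^sub>1"
    and p: "is_contraction K A Cyl i\<^sub>0 i\<^sub>1 p"
    and v: "is_involution K A Cyl i\<^sub>0 i\<^sub>1 v" and pv: "involution_compatible K p v"
    and S: "is_subdivision K A Cyl i\<^sub>0 i\<^sub>1 S r\<^sub>0 r\<^sub>1 s"
    and ps: "subdivision_compatible K A p S r\<^sub>0 r\<^sub>1 s"
    and \<Gamma>: "is_upper_left_connection K A Cyl i\<^sub>0 i\<^sub>1 p \<Gamma>"
    and pres: "preserves_subdivision K A Cyl i\<^sub>0 i\<^sub>1 r\<^sub>0 r\<^sub>1"
  shows "cylinder_category (Hom K T A) (\<lambda>x. Cyl \<odot> x) (\<lambda>x. S \<odot> x) (\<lambda>f. Cyl \<triangleright> f)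
    (\<lambda>x. i\<^sub>0 \<triangleleft> x) (\<lambda>x. i\<^sub>1 \<triangleleft> x) (\<lambda>x. p \<triangleleft> x) (\<lambda>x. v \<triangleleft> x) (\<lambda>x. \<Gamma> \<triangleleft> x)
    (\<lambda>x. r\<^sub>0 \<triangleleft> x) (\<lambda>x. r\<^sub>1 \<triangleleft> x) (\<lambda>x. s \<triangleleft> x) (\<lambda>x. p_bar K A p S r\<^sub>0 r\<^sub>1 \<triangleleft> x)"
proof -
  let ?D = "Hom K T A" and ?E = "Hom K A A" and ?q = "p_bar K A p S r\<^sub>0 r\<^sub>1"
  have Cyl: "Cyl \<in> hom (Cells1 K) A A" and i\<^sub>0: "i\<^sub>0 \<in> hom ?E (id1 A) Cyl"
    and i\<^sub>1: "i\<^sub>1 \<in> hom ?E (id1 A) Cyl"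
    using cyl by (auto simp: is_cylinder_def Hom_simps)
  have id: "id1 A \<in> hom (Cells1 K) A A" using i\<^sub>0 by (simp add: in_Hom_iff)
  have p': "p \<in> hom ?E Cyl (id1 A)" "p \<bullet> i\<^sub>0 = id2 (id1 A)" "p \<bullet> i\<^sub>1 = id2 (id1 A)"
    using p by (auto simp: is_contraction_def)
  have v': "v \<in> hom ?E Cyl Cyl" "v \<bullet> i\<^sub>0 = i\<^sub>1" "v \<bullet> i\<^sub>1 = i\<^sub>0" "p \<bullet> v = p"
    using v pv by (auto simp: is_involution_def involution_compatible_def)
  have S': "r\<^sub>0 \<in> hom ?E Cyl S" "r\<^sub>1 \<in> hom ?E Cyl S" "s \<in> hom ?E Cyl S"
    "is_pushout ?E i\<^sub>0 i\<^sub>1 r\<^sub>0 r\<^sub>1" "s \<bullet> i\<^sub>0 = r\<^sub>1 \<bullet> i\<^sub>0" "s \<bullet> i\<^sub>1 = r\<^sub>0 \<bullet> i\<^sub>1"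
    using S by (auto simp: is_subdivision_def)
  note q = p_bar_props[OF p S]
  have qs: "?q \<bullet> s = p" using ps by (simp add: subdivision_compatible_def)
  have CC: "Cyl \<odot> Cyl \<in> hom (Cells1 K) A A" using Comp1_hom[OF Cyl Cyl] .
  have \<Gamma>': "\<Gamma> \<in> hom ?E (Cyl \<odot> Cyl) Cyl" "\<Gamma> \<bullet> (i\<^sub>0 \<triangleleft> Cyl) = id2 Cyl"
    "\<Gamma> \<bullet> (Cyl \<triangleright> i\<^sub>0) = id2 Cyl" "\<Gamma> \<bullet> (i\<^sub>1 \<triangleleft> Cyl) = i\<^sub>1 \<bullet> p" "\<Gamma> \<bullet> (Cyl \<triangleright> i\<^sub>1) = i\<^sub>1 \<bullet> p"
    using \<Gamma> by (auto simp: is_upper_left_connection_def)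
  have pc: "is_pushout ?E (Cyl \<triangleright> i\<^sub>0) (Cyl \<triangleright> i\<^sub>1) (Cyl \<triangleright> r\<^sub>0) (Cyl \<triangleright> r\<^sub>1)"
    using pres by (simp add: preserves_subdivision_def)
  have iC: "i\<^sub>0 \<triangleleft> Cyl \<in> hom ?E Cyl (Cyl \<odot> Cyl)" "i\<^sub>1 \<triangleleft> Cyl \<in> hom ?E Cyl (Cyl \<odot> Cyl)"
    using whisker_right_hom[OF Cyl i\<^sub>0] whisker_right_hom[OF Cyl i\<^sub>1] id1_Comp1[OF Cyl] by auto
  have Ci: "Cyl \<triangleright> i\<^sub>0 \<in> hom ?E Cyl (Cyl \<odot> Cyl)" "Cyl \<triangleright> i\<^sub>1 \<in> hom ?E Cyl (Cyl \<odot> Cyl)"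
    using whisker_left_hom[OF Cyl i\<^sub>0] whisker_left_hom[OF Cyl i\<^sub>1]
      category.Comp_Id[OF category_Cells1 Cyl] by auto
  note hom_right = whisker_right_hom[where X = T]
  note comp_right = whisker_right_Comp2[where X = T, symmetric]
  interpret category ?D by (rule category_Hom)
  show ?thesis
  proof (unfold_locales, unfold Hom_simps)
    fix f x y assume f: "f \<in> hom ?D x y"
    show "Cyl \<triangleright> f \<in> hom ?D (Cyl \<odot> x) (Cyl \<odot> y)" using whisker_left_hom[OF Cyl f] .
    show "Cyl \<triangleright> f \<bullet> (i\<^sub>0 \<triangleleft> x) = (i\<^sub>0 \<triangleleft> y) \<bullet> f"
      using whisker_naturality[OF i\<^sub>0 f] id1_whisker_left[OF f] by simp
    show "Cyl \<triangleright> f \<bullet> (i\<^sub>1 \<triangleleft> x) = (i\<^sub>1 \<triangleleft> y) \<bullet> f"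
      using whisker_naturality[OF i\<^sub>1 f] id1_whisker_left[OF f] by simp
    show "(p \<triangleleft> y) \<bullet> Cyl \<triangleright> f = f \<bullet> (p \<triangleleft> x)"
      using whisker_naturality[OF p'(1) f] id1_whisker_left[OF f] by simp
    fix g z assume g: "g \<in> hom ?D y z"
    show "Cyl \<triangleright> (g \<bullet> f) = Cyl \<triangleright> g \<bullet> Cyl \<triangleright> f" using whisker_left_Comp2[OF Cyl f g] .
  next
    fix x assume x: "x \<in> hom (Cells1 K) T A"
    note ix = id1_Comp1[OF x]
    have Ob: "x \<in> Obj ?D" using x by (simp add: Hom_simps)
    show "i\<^sub>0 \<triangleleft> x \<in> hom ?D x (Cyl \<odot> x)" "i\<^sub>1 \<triangleleft> x \<in> hom ?D x (Cyl \<odot> x)"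
      "p \<triangleleft> x \<in> hom ?D (Cyl \<odot> x) x" "?q \<triangleleft> x \<in> hom ?D (S \<odot> x) x"
      using hom_right[OF x i\<^sub>0] hom_right[OF x i\<^sub>1] hom_right[OF x p'(1)] hom_right[OF x q(1)] ix
      by auto
    show "v \<triangleleft> x \<in> hom ?D (Cyl \<odot> x) (Cyl \<odot> x)" "r\<^sub>0 \<triangleleft> x \<in> hom ?D (Cyl \<odot> x) (S \<odot> x)"
      "r\<^sub>1 \<triangleleft> x \<in> hom ?D (Cyl \<odot> x) (S \<odot> x)" "s \<triangleleft> x \<in> hom ?D (Cyl \<odot> x) (S \<odot> x)"
      using hom_right[OF x v'(1)] hom_right[OF x S'(1)] hom_right[OF x S'(2)] hom_right[OF x S'(3)]
      by auto
    show "\<Gamma> \<triangleleft> x \<in> hom ?D (Cyl \<odot> Cyl \<odot> x) (Cyl \<odot> x)"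
      using hom_right[OF x \<Gamma>'(1)] Comp1_assoc[OF x Cyl Cyl] by simp
    show "(p \<triangleleft> x) \<bullet> (i\<^sub>0 \<triangleleft> x) = id2 x" "(p \<triangleleft> x) \<bullet> (i\<^sub>1 \<triangleleft> x) = id2 x"
      using comp_right[OF x i\<^sub>0 p'(1)] comp_right[OF x i\<^sub>1 p'(1)] p'(2,3)
        id2_whisker_right[OF x id] ix by auto
    show "(v \<triangleleft> x) \<bullet> (i\<^sub>0 \<triangleleft> x) = i\<^sub>1 \<triangleleft> x" "(v \<triangleleft> x) \<bullet> (i\<^sub>1 \<triangleleft> x) = i\<^sub>0 \<triangleleft> x"
      "(p \<triangleleft> x) \<bullet> (v \<triangleleft> x) = p \<triangleleft> x"
      using comp_right[OF x i\<^sub>0 v'(1)] comp_right[OF x i\<^sub>1 v'(1)] comp_right[OF x v'(1) p'(1)] v'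
      by auto
    show "(\<Gamma> \<triangleleft> x) \<bullet> (i\<^sub>0 \<triangleleft> (Cyl \<odot> x)) = id2 (Cyl \<odot> x)"
      "(\<Gamma> \<triangleleft> x) \<bullet> (i\<^sub>1 \<triangleleft> (Cyl \<odot> x)) = (i\<^sub>1 \<triangleleft> x) \<bullet> (p \<triangleleft> x)"
      using comp_right[OF x iC(1) \<Gamma>'(1)] comp_right[OF x iC(2) \<Gamma>'(1)] \<Gamma>'
        comp_right[OF x p'(1) i\<^sub>1] id2_whisker_right[OF x Cyl]
        whisker_right_Comp1[OF x Cyl i\<^sub>0] whisker_right_Comp1[OF x Cyl i\<^sub>1] by auto
    show "(\<Gamma> \<triangleleft> x) \<bullet> Cyl \<triangleright> (i\<^sub>0 \<triangleleft> x) = id2 (Cyl \<odot> x)"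
      "(\<Gamma> \<triangleleft> x) \<bullet> Cyl \<triangleright> (i\<^sub>1 \<triangleleft> x) = (i\<^sub>1 \<triangleleft> x) \<bullet> (p \<triangleleft> x)"
      using comp_right[OF x Ci(1) \<Gamma>'(1)] comp_right[OF x Ci(2) \<Gamma>'(1)] \<Gamma>'
        comp_right[OF x p'(1) i\<^sub>1] id2_whisker_right[OF x Cyl]
        whisker_right_whisker_left[OF x i\<^sub>0 Cyl] whisker_right_whisker_left[OF x i\<^sub>1 Cyl] by auto
    show "is_pushout ?D (i\<^sub>0 \<triangleleft> x) (i\<^sub>1 \<triangleleft> x) (r\<^sub>0 \<triangleleft> x) (r\<^sub>1 \<triangleleft> x)"
      using eval_pushout[OF A_in_Obj A_in_Obj Ob S'(4)] .
    show "is_pushout ?D (Cyl \<triangleright> (i\<^sub>0 \<triangleleft> x)) (Cyl \<triangleright> (i\<^sub>1 \<triangleleft> x)) (Cyl \<triangleright> (r\<^sub>0 \<triangleleft> x)) (Cyl \<triangleright> (r\<^sub>1 \<triangleleft> x))"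
      using eval_pushout[OF A_in_Obj A_in_Obj Ob pc]
      by (simp only: whisker_right_whisker_left[OF x i\<^sub>0 Cyl] whisker_right_whisker_left[OF x i\<^sub>1 Cyl]
          whisker_right_whisker_left[OF x S'(1) Cyl] whisker_right_whisker_left[OF x S'(2) Cyl])
    show "(s \<triangleleft> x) \<bullet> (i\<^sub>0 \<triangleleft> x) = (r\<^sub>1 \<triangleleft> x) \<bullet> (i\<^sub>0 \<triangleleft> x)"
      "(s \<triangleleft> x) \<bullet> (i\<^sub>1 \<triangleleft> x) = (r\<^sub>0 \<triangleleft> x) \<bullet> (i\<^sub>1 \<triangleleft> x)"
      using comp_right[OF x i\<^sub>0 S'(3)] comp_right[OF x i\<^sub>0 S'(2)] comp_right[OF x i\<^sub>1 S'(3)]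
        comp_right[OF x i\<^sub>1 S'(1)] S'(5,6) by auto
    show "(?q \<triangleleft> x) \<bullet> (r\<^sub>0 \<triangleleft> x) = p \<triangleleft> x" "(?q \<triangleleft> x) \<bullet> (r\<^sub>1 \<triangleleft> x) = p \<triangleleft> x"
      "(?q \<triangleleft> x) \<bullet> (s \<triangleleft> x) = p \<triangleleft> x"
      using comp_right[OF x S'(1) q(1)] comp_right[OF x S'(2) q(1)] comp_right[OF x S'(3) q(1)]
        q(2,3) qs by auto
  qed
qed

section \<open>Homotopy equivalences between fibrations\<close>

theorem mainTheorem7:
  fixes K :: "('o, 'm, 'c) two_category_data" (structure)
    and T A :: 'o
    and Cyl S :: 'm
    and i\<^sub>0 i\<^sub>1 p v r\<^sub>0 r\<^sub>1 s \<Gamma> :: 'c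
    and a a\<^sub>0 a\<^sub>1 :: 'm
    and j\<^sub>0 j\<^sub>1 f :: 'c
  assumes "formal_category K T A"
    and "is_cylinder K A Cyl i\<^sub>0 i\<^sub>1"
    and "is_contraction K A Cyl i\<^sub>0 i\<^sub>1 p"
    and "is_involution K A Cyl i\<^sub>0 i\<^sub>1 v"
    and "involution_compatible K p v"
    and "is_subdivision K A Cyl i\<^sub>0 i\<^sub>1 S r\<^sub>0 r\<^sub>1 s"
    and "subdivision_compatible K A p S r\<^sub>0 r\<^sub>1 s"
    and "is_upper_left_connection K A Cyl i\<^sub>0 i\<^sub>1 p \<Gamma>"
    and "preserves_subdivision K A Cyl i\<^sub>0 i\<^sub>1 r\<^sub>0 r\<^sub>1"
    and "j\<^sub>0 \<in> hom (Hom K T A) a\<^sub>0 a"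
    and "j\<^sub>1 \<in> hom (Hom K T A) a\<^sub>1 a"
    and "is_fibration K T A Cyl i\<^sub>0 a\<^sub>0 a j\<^sub>0"
    and "is_fibration K T A Cyl i\<^sub>0 a\<^sub>1 a j\<^sub>1"
    and "f \<in> hom (Hom K T A) a\<^sub>0 a\<^sub>1"
    and "j\<^sub>1 \<bullet> f = j\<^sub>0"
    and "is_homotopy_equivalence K T A Cyl i\<^sub>0 i\<^sub>1 a\<^sub>0 a\<^sub>1 f"
  shows "is_homotopy_equivalence_over K T A Cyl i\<^sub>0 i\<^sub>1 p a a\<^sub>0 a\<^sub>1 j\<^sub>0 j\<^sub>1 f"
proof -
  interpret formal_category K T A by fact
  interpret Q: cylinder_category "Hom K T A" "\<lambda>x. Cyl \<odot> x" "\<lambda>x. S \<odot> x" "\<lambda>f. Cyl \<triangleright> f"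
    "\<lambda>x. i\<^sub>0 \<triangleleft> x" "\<lambda>x. i\<^sub>1 \<triangleleft> x" "\<lambda>x. p \<triangleleft> x" "\<lambda>x. v \<triangleleft> x" "\<lambda>x. \<Gamma> \<triangleleft> x"
    "\<lambda>x. r\<^sub>0 \<triangleleft> x" "\<lambda>x. r\<^sub>1 \<triangleleft> x" "\<lambda>x. s \<triangleleft> x" "\<lambda>x. p_bar K A p S r\<^sub>0 r\<^sub>1 \<triangleleft> x"
    by (rule cylinder_category_evaluation[OF assms(2-9)])
  have fib: "Q.fibration x y j" if "is_fibration K T A Cyl i\<^sub>0 x y j" for x y j
    using that unfolding is_fibration_def Q.fibration_def by (simp add: Hom_simps)
  from assms(16) obtain g h h' where g: "g \<in> hom (Hom K T A) a\<^sub>1 a\<^sub>0"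
    and h: "is_homotopy K T A Cyl i\<^sub>0 i\<^sub>1 a\<^sub>0 a\<^sub>0 (g \<bullet> f) (id2 a\<^sub>0) h"
    and h': "is_homotopy K T A Cyl i\<^sub>0 i\<^sub>1 a\<^sub>1 a\<^sub>1 (f \<bullet> g) (id2 a\<^sub>1) h'"
    unfolding is_homotopy_equivalence_def by blast
  have plain: "Q.homotopic {} x y f\<^sub>0 f\<^sub>1" if "is_homotopy K T A Cyl i\<^sub>0 i\<^sub>1 x y f\<^sub>0 f\<^sub>1 h" for x y f\<^sub>0 f\<^sub>1 h
    using that Q.homD(1)[of f\<^sub>0 x y] unfolding is_homotopy_def Q.homotopic_def
    by (auto simp: Hom_simps)
  \<comment> \<open>Naturality of \<open>p\<close> identifies the constant homotopy \<open>j (p \<triangleleft> x)\<close> with \<open>(p \<triangleleft> a) (Cyl \<triangleright> j)\<close>.\<close>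
  have over: "\<exists>h. is_homotopy_over K T A Cyl i\<^sub>0 i\<^sub>1 p a x x j j e (id2 x) h"
    if H: "Q.homotopic {j} x x e (id2 x)" and j: "j \<in> hom (Hom K T A) x a" for x j e
  proof -
    have "j \<bullet> e = j \<bullet> id2 x"
      using Q.homotopic_ends[OF H] by (simp add: Hom_simps)
    also have "\<dots> = j" using Q.Comp_Id[OF j] by (simp add: Hom_simps)
    finally have je: "j \<bullet> e = j" .
    then show ?thesis
      using H Q.p_nat[OF j] j Q.Comp_Id[OF j] Q.homotopic_hom[OF H]
      unfolding Q.homotopic_def is_homotopy_over_def is_homotopy_def
      by (auto simp: Hom_simps)
  qed
  obtain F where F: "F \<in> hom (Hom K T A) a\<^sub>1 a\<^sub>0" "j\<^sub>0 \<bullet> F = j\<^sub>1"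
    "Q.homotopic {j\<^sub>0} a\<^sub>0 a\<^sub>0 (F \<bullet> f) (id2 a\<^sub>0)" "Q.homotopic {j\<^sub>1} a\<^sub>1 a\<^sub>1 (f \<bullet> F) (id2 a\<^sub>1)"
    using Q.homotopy_inverse_over[OF fib[OF assms(12)] fib[OF assms(13)] assms(14) _ g]
      assms(15) plain[OF h] plain[OF h'] by (auto simp: Hom_simps)
  show ?thesis
    unfolding is_homotopy_equivalence_over_def
    using assms(10,11,14,15) F(1,2) over[OF F(3) assms(10)] over[OF F(4) assms(11)] by blast
qed

end
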